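(* For a nonnegative integer $n$, $$\sum_{p+q=2n+1}(p+1)\zeta^\star(\{1\}^{p+1},q+2)-\sum_{p+q=2n+1}G_{q+2}(1,p)=\binom{2n+4}{3}\zeta(2n+4)+\sum_{j=1}^n(-1)^j\sum_{|c_j|=2n+1-2j}\zeta(c_{j0}+3,c_{j1}+2,\ldots,c_{jj}+2)\,W(c_j),$$ where $W(c_j)=W(c_{j0},c_{j1},\ldots,c_{jj})=\binom{c_{j0}+3}{3}(c_{j1}+1)\cdots(c_{jj}+1)$.
   Context: $\zeta(\alpha_1,\ldots,\alpha_k)=\sum_{1\le k_1<\cdots<k_k}k_1^{-\alpha_1}\cdots k_k^{-\alpha_k}$; $\zeta^\star(\alpha_1,\ldots,\alpha_k)=\sum_{1\le k_1\le\cdots\le k_k}k_1^{-\alpha_1}\cdots k_k^{-\alpha_k}$; $\{a\}^k$ denotes $k$ repetitions of $a$. The sums over $p+q=2n+1$ are over nonnegative integers $p,q$. For each $j$, $\sum_{|c_j|=2n+1-2j}$ is over all $(j+1)$-tuples $c_j=(c_{j0},c_{j1},\ldots,c_{jj})$ of nonnegative integers with $c_{j0}+c_{j1}+\cdots+c_{jj}=2n+1-2j$. For nonnegative integers $n,p,q$, $$G_{n+2}(p,q)=\sum_{1\le k_1<\cdots<k_{p+1}}\frac{1}{k_1\cdots k_p\,k_{p+1}^{n+2}}\sum_{1\le \ell_1\le\cdots\le\ell_q\le k_{p+1}}\frac{1}{\ell_1\cdots\ell_q}.$$ *)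

theory Defs
  imports "HOL-Analysis.Analysis"
begin

definition mzv :: "nat list \<Rightarrow> real" where
  "mzv s = (\<Sum>\<^sub>\<infinity> ks \<in> {ks. length ks = length s \<and> sorted_wrt (<) ks \<and> (\<forall>k\<in>set ks. 1 \<le> k)}.
              \<Prod>i<length s. 1 / real (ks ! i) ^ (s ! i))"

definition mzsv :: "nat list \<Rightarrow> real" where
  "mzsv s = (\<Sum>\<^sub>\<infinity> ks \<in> {ks. length ks = length s \<and> sorted ks \<and> (\<forall>k\<in>set ks. 1 \<le> k)}.
              \<Prod>i<length s. 1 / real (ks ! i) ^ (s ! i))"

definition G :: "nat \<Rightarrow> nat \<Rightarrow> nat \<Rightarrow> real" where
  "G m p q = (\<Sum>\<^sub>\<infinity> ks \<in> {ks. length ks = p + 1 \<and> sorted_wrt (<) ks \<and> (\<forall>k\<in>set ks. 1 \<le> k)}.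
      (\<Prod>i<p. 1 / real (ks ! i)) * (1 / real (ks ! p) ^ m) *
      (\<Sum>ls \<in> {ls. length ls = q \<and> sorted ls \<and> (\<forall>l\<in>set ls. 1 \<le> l \<and> l \<le> ks ! p)}.
          \<Prod>i<q. 1 / real (ls ! i)))"

definition W :: "nat list \<Rightarrow> real" where
  "W c = real ((hd c + 3) choose 3) * (\<Prod>x\<leftarrow>tl c. real (x + 1))"

end

theory Submission
  imports Defs
begin

text \<open>
  Both sides are coefficients of power series in a small \<open>x > 0\<close>, and the identity holds in every
  degree, not only the odd ones. With $h_k(x) = \prod_{i \le k} i/(i-x)$ the left side is generated by
  $$F(x) = \sum_{k \ge 1} \frac{h_k(x)}{k(k-x)} \Bigl(\sum_{i \le k} \frac{1}{i-x} - \sum_{i<k} \frac1i\Bigr),$$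
  and the right side by
  $$R(x) = \sum_{k \ge 1} \frac{k}{(k-x)^4} \prod_{i>k} \Bigl(1 - \frac{x^2}{(i-x)^2}\Bigr).$$
  They agree because $F$ is the derivative at $y = 0$ of
  $\sum_k \frac{1}{k-x} \prod_{i<k}(i-y) / \prod_{i\le k}(i-x-y)$: expanding each summand into partial
  fractions in $y$ gives nonnegative coefficients when \<open>0 < x < 1\<close>, so the order of summation may be
  exchanged, and the resulting inner sums are Beta values, which are the infinite products in $R$.
\<close>

section \<open>Double sums and power series\<close>

text \<open>Generating functions remove the outer sums: the complete homogeneous sums of 1, 1/2,
  ..., 1/k inside both zeta-star and \<open>G\<close> are the coefficients of h_k(x), the weight p +
  1 comes from d/dx, and the powers k^(-q-2) form a geometric series. On the other side the factors
  of \<open>W\<close> are coefficients of (1 - x/k)^(-4) and (1 - x/l)^(-2), and the alternating sum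
  over j is the infinite product multiplied out. The variable y never enters the formal argument:
  its partial fraction coefficients are free of y, so differentiating at y = 0 merely squares
  denominators, and the two finite identities that result are proved by induction. The infinite
  product is likewise handled only through its recurrence in k and its limit 1. Nearly every
  interchange of sums rests on nonnegative terms, hence on x > 0; signs occur only in the depth j,
  after the unsigned series has been summed. The bound x <= 1/8 is a convenient one: h_k(x) grows
  like k^x, which must leave the series in k convergent, and the terms of depth j must decay
  geometrically in j.\<close>

lemma has_sum_Sigma_nonneg:
  fixes f :: "'a \<times> 'b \<Rightarrow> real"
  assumes "\<And>a. a \<in> A \<Longrightarrow> ((\<lambda>b. f (a, b)) has_sum g a) (B a)" "(g has_sum S) A"
    and "\<And>a b. a \<in> A \<Longrightarrow> b \<in> B a \<Longrightarrow> f (a, b) \<ge> 0"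
  shows "(f has_sum S) (Sigma A B)"
  using has_sum_SigmaI[OF assms(1,2)] summable_on_SigmaI[OF assms(1) _ assms(3)] assms(2)
  by (auto simp: summable_on_def)

lemma summable_on_swap_nonneg:
  fixes f :: "'a \<Rightarrow> 'b \<Rightarrow> real"
  assumes "\<And>a. a \<in> A \<Longrightarrow> (f a has_sum g a) B" "(g has_sum S) A"
    and "\<And>a b. a \<in> A \<Longrightarrow> b \<in> B \<Longrightarrow> f a b \<ge> 0" and "b \<in> B"
  shows "(\<lambda>a. f a b) summable_on A"
proof (rule summable_on_comparison_test)
  show "g summable_on A" using assms(2) by (auto simp: summable_on_def)
  show "f a b \<le> g a" if "a \<in> A" for a
    using has_sum_mono2[OF has_sum_finite[of "{b}" "f a"] assms(1)[OF that]] assms(3,4) that by auto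
qed (use assms in auto)

text \<open>Tonelli: nonnegativity turns convergence of the iterated sum into summability over the
  product, where the order of the two indices is immaterial.\<close>

lemma has_sum_swap_nonneg:
  fixes f :: "'a \<Rightarrow> 'b \<Rightarrow> real"
  assumes "\<And>a. a \<in> A \<Longrightarrow> (f a has_sum g a) B" "(g has_sum S) A"
    and "\<And>a b. a \<in> A \<Longrightarrow> b \<in> B \<Longrightarrow> f a b \<ge> 0"
    and "\<And>b. b \<in> B \<Longrightarrow> ((\<lambda>a. f a b) has_sum h b) A"
  shows "(h has_sum S) B"
proof -
  have "((\<lambda>(a, b). f a b) has_sum S) (A \<times> B)"
    by (rule has_sum_Sigma_nonneg) (use assms in auto)
  hence "((\<lambda>(b, a). f a b) has_sum S) (B \<times> A)"
    by (subst has_sum_swap) (simp add: case_prod_unfold)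
  thus ?thesis
    by (rule has_sum_SigmaD) (use assms in auto)
qed

lemma has_sum_sum:
  fixes f :: "'i \<Rightarrow> 'a \<Rightarrow> real"
  assumes "\<And>i. i \<in> I \<Longrightarrow> (f i has_sum S i) A"
  shows "((\<lambda>a. \<Sum>i\<in>I. f i a) has_sum (\<Sum>i\<in>I. S i)) A"
  using assms by (induction I rule: infinite_finite_induct) (auto intro!: has_sum_add)

text \<open>The hypothesis is one-sided because the generating functions are compared only for x >
  0. Once the lower coefficients vanish, dividing by x^n leaves a series that is 0 on (0, r) and
  tends to a n at 0.\<close>

lemma powser_coeffs_eq_0:
  fixes a :: "nat \<Rightarrow> real"
  assumes "r > 0" "\<And>x. 0 < x \<Longrightarrow> x < r \<Longrightarrow> (\<lambda>n. a n * x ^ n) sums 0"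
  shows "a n = 0"
proof (induction n rule: less_induct)
  case (less n)
  define f where "f = (\<lambda>x. \<Sum>m. a (m + n) * x ^ m)"
  have z: "(\<lambda>m. a (m + n) * x ^ m) sums 0" if x: "0 < x" "x < r" for x
  proof -
    have "(\<lambda>m. a (m + n) * x ^ (m + n)) sums (0 - (\<Sum>m<n. a m * x ^ m))"
      using sums_iff_shift[of "\<lambda>m. a m * x ^ m" n] assms(2)[OF x] by (simp add: sums_iff)
    also have "(\<Sum>m<n. a m * x ^ m) = 0" using less by simp
    finally have "(\<lambda>m. (a (m + n) * x ^ m) * x ^ n) sums (0 * x ^ n)"
      by (simp add: power_add mult_ac)
    thus ?thesis using x by (subst (asm) sums_mult2_iff) auto
  qed
  have "(f \<longlongrightarrow> a (0 + n)) (at 0)"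
  proof (rule powser_limit_0[of "r/2"])
    fix x :: real assume "norm x < r / 2"
    thus "(\<lambda>m. a (m + n) * x ^ m) sums f x"
      using powser_inside[of "\<lambda>m. a (m + n)" "r/2" x] z[of "r/2"] assms(1)
      by (auto simp: f_def sums_iff)
  qed (use assms in auto)
  hence "(f \<longlongrightarrow> a n) (at_right 0)" by (simp add: filterlim_at_split)
  moreover have "eventually (\<lambda>x. f x = 0) (at_right 0)"
    using eventually_at_right_less eventually_at_right[OF assms(1)] assms(1)
    unfolding f_def by (auto simp: eventually_at_right_field intro!: exI[of _ r] sums_unique[symmetric] z)
  hence "(f \<longlongrightarrow> 0) (at_right 0)" by (rule tendsto_eventually)
  ultimately show ?case by (intro tendsto_unique[of "at_right 0"]) auto
qed

section \<open>Complete homogeneous sums of reciprocals\<close>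

text \<open>The inner sum of \<open>G\<close> word for word, with k for the outermost index. It is
  also what remains of zeta-star({1}^p, m) when the largest index is fixed to k.\<close>

definition hsym :: "nat \<Rightarrow> nat \<Rightarrow> real" where
  "hsym p k = (\<Sum>ls \<in> {ls. length ls = p \<and> sorted ls \<and> (\<forall>l\<in>set ls. 1 \<le> l \<and> l \<le> k)}. \<Prod>i<p. 1 / real (ls ! i))"

lemma finite_sorted_lists: "finite {ls. length ls = p \<and> sorted ls \<and> (\<forall>l\<in>set ls. 1 \<le> l \<and> l \<le> (k::nat))}"
  by (rule finite_subset[OF _ finite_lists_length_eq[of "{1..k}" p]]) auto

lemma hsym_nonneg: "hsym p k \<ge> 0"
  unfolding hsym_def by (intro sum_nonneg prod_nonneg) auto

lemma hsym_0: "hsym 0 k = 1"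
proof -
  have "{ls. length ls = 0 \<and> sorted ls \<and> (\<forall>l\<in>set ls. 1 \<le> l \<and> l \<le> k)} = {[]}" by auto
  thus ?thesis by (simp add: hsym_def)
qed

lemma hsym_Suc_0: "hsym (Suc p) 0 = 0"
proof -
  have "{ls. length ls = Suc p \<and> sorted ls \<and> (\<forall>l\<in>set ls. 1 \<le> l \<and> l \<le> (0::nat))} = {}"
    by (auto simp: length_Suc_conv)
  thus ?thesis by (simp only: hsym_def sum.empty)
qed

text \<open>Split by whether the last entry is Suc k. If it is, removing it leaves p entries that
  may still reach Suc k, since repetitions are allowed.\<close>

lemma hsym_Suc_Suc: "hsym (Suc p) (Suc k) = hsym (Suc p) k + hsym p (Suc k) / real (Suc k)"
proof -
  define L where "L = (\<lambda>p k. {ls. length ls = p \<and> sorted ls \<and> (\<forall>l\<in>set ls. 1 \<le> l \<and> l \<le> (k::nat))})"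
  have fin: "finite (L p k)" for p k unfolding L_def by (rule finite_sorted_lists)
  have eq: "L (Suc p) (Suc k) = L (Suc p) k \<union> (\<lambda>ls. ls @ [Suc k]) ` L p (Suc k)"
  proof (intro set_eqI iffI)
    fix ls assume ls: "ls \<in> L (Suc p) (Suc k)"
    then obtain xs y where xy: "ls = xs @ [y]"
      by (cases ls rule: rev_cases) (auto simp: L_def)
    show "ls \<in> L (Suc p) k \<union> (\<lambda>ls. ls @ [Suc k]) ` L p (Suc k)"
    proof (cases "y = Suc k")
      case False
      thus ?thesis using ls xy by (force simp: L_def sorted_append)
    qed (use ls xy in \<open>auto simp: L_def sorted_append\<close>)
  qed (force simp: L_def sorted_append)
  have disj: "L (Suc p) k \<inter> (\<lambda>ls. ls @ [Suc k]) ` L p (Suc k) = {}"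
    by (auto simp: L_def)
  have hsym: "hsym p k = (\<Sum>ls\<in>L p k. \<Prod>i<p. 1 / real (ls ! i))" for p k
    by (simp add: hsym_def L_def)
  have "hsym (Suc p) (Suc k) = hsym (Suc p) k
      + (\<Sum>ls\<in>(\<lambda>ls. ls @ [Suc k]) ` L p (Suc k). \<Prod>i<Suc p. 1 / real (ls ! i))"
    unfolding hsym eq by (intro sum.union_disjoint fin disj finite_imageI)
  also have "(\<Sum>ls\<in>(\<lambda>ls. ls @ [Suc k]) ` L p (Suc k). \<Prod>i<Suc p. 1 / real (ls ! i))
      = (\<Sum>ls\<in>L p (Suc k). (\<Prod>i<p. 1 / real (ls ! i)) / real (Suc k))"
    by (subst sum.reindex) (auto simp: inj_on_def L_def nth_append intro!: sum.cong)
  also have "\<dots> = hsym p (Suc k) / real (Suc k)"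
    unfolding hsym by (rule sum_divide_distrib[symmetric])
  finally show ?thesis .
qed

definition hprod :: "nat \<Rightarrow> real \<Rightarrow> real" where
  "hprod k x = (\<Prod>i=1..k. real i / (real i - x))"

text \<open>The logarithmic derivative of \<open>hprod k\<close>.\<close>

definition ssum :: "nat \<Rightarrow> real \<Rightarrow> real" where
  "ssum k x = (\<Sum>i=1..k. 1 / (real i - x))"

lemma hprod_Suc: "hprod (Suc k) x = hprod k x * (real (Suc k) / (real (Suc k) - x))"
  by (simp add: hprod_def)

lemma ssum_Suc: "ssum (Suc k) x = ssum k x + 1 / (real (Suc k) - x)"
  by (simp add: ssum_def)

text \<open>Here p - i counts the copies of Suc k, so this is the coefficient form of multiplying by
  the geometric series 1 / (1 - x / (k + 1)).\<close>

lemma hsym_Suc_eq_sum: "hsym p (Suc k) = (\<Sum>i\<le>p. hsym i k * (1 / real (Suc k)) ^ (p - i))"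
proof (induction p)
  case (Suc p)
  have "(\<Sum>i\<le>Suc p. hsym i k * (1 / real (Suc k)) ^ (Suc p - i))
      = hsym (Suc p) k + (\<Sum>i\<le>p. hsym i k * (1 / real (Suc k)) ^ (p - i)) / real (Suc k)"
    by (simp add: Suc_diff_le sum_divide_distrib)
  thus ?case using Suc by (simp add: hsym_Suc_Suc)
qed (simp add: hsym_0)

lemma hsym_sums:
  assumes "\<bar>x\<bar> < 1"
  shows "(\<lambda>p. hsym p k * x ^ p) sums hprod k x"
proof -
  have "(\<lambda>p. hsym p k * x ^ p) sums hprod k x \<and> summable (\<lambda>p. norm (hsym p k * x ^ p))"
    using assms
  proof (induction k arbitrary: x)
    case 0
    have eq: "hsym p 0 * x ^ p = (if p = 0 then 1 else 0)" for p
      by (cases p) (auto simp: hsym_0 hsym_Suc_0)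
    show ?case unfolding eq using sums_single[of 0 "\<lambda>_. 1::real"]
      by (auto simp: hprod_def sums_iff)
  next
    case (Suc k)
    have step: "(\<lambda>p. hsym p (Suc k) * y ^ p) sums hprod (Suc k) y" if y: "\<bar>y\<bar> < 1" for y
    proof -
      have ny: "norm (y / real (Suc k)) < 1" using y by (simp add: field_simps)
      have g: "summable (\<lambda>p. norm ((y / real (Suc k)) ^ p))"
        unfolding norm_power by (rule summable_geometric) (use ny in simp)
      have "(\<lambda>p. \<Sum>i\<le>p. (hsym i k * y ^ i) * (y / real (Suc k)) ^ (p - i)) sums
         ((\<Sum>p. hsym p k * y ^ p) * (\<Sum>p. (y / real (Suc k)) ^ p))"
        by (rule Cauchy_product_sums[OF _ g]) (use Suc.IH[OF y] in auto)
      also have "(\<Sum>p. hsym p k * y ^ p) = hprod k y" using Suc.IH[OF y] by (simp add: sums_iff)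
      also have "(\<Sum>p. (y / real (Suc k)) ^ p) = 1 / (1 - y / real (Suc k))"
        using ny by (rule suminf_geometric)
      also have "\<dots> = real (Suc k) / (real (Suc k) - y)" using y by (simp add: field_simps)
      also have "(\<lambda>p. \<Sum>i\<le>p. (hsym i k * y ^ i) * (y / real (Suc k)) ^ (p - i))
         = (\<lambda>p. hsym p (Suc k) * y ^ p)"
      proof
        fix p
        show "(\<Sum>i\<le>p. (hsym i k * y ^ i) * (y / real (Suc k)) ^ (p - i)) = hsym p (Suc k) * y ^ p"
          unfolding hsym_Suc_eq_sum sum_distrib_right
          by (intro sum.cong) (auto simp: power_divide simp flip: power_add)
      qed
      finally show ?thesis by (simp add: hprod_Suc)
    qed
    \<comment> \<open>The Cauchy product requires absolute summability, so it is carried through the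
      induction. As the coefficients are nonnegative, it is plain summability at the absolute value
      of x.\<close>
    show ?case using step[OF Suc.prems] step[of "\<bar>x\<bar>"] Suc.prems
      by (simp add: sums_iff abs_mult power_abs hsym_nonneg)
  qed
  thus ?thesis by blast
qed

lemma hprod_has_field_derivative:
  assumes "x < 1"
  shows "(hprod k has_field_derivative hprod k x * ssum k x) (at x)"
proof (induction k)
  case 0
  show ?case by (simp add: hprod_def[abs_def] ssum_def)
next
  case (Suc k)
  have "((\<lambda>x. hprod k x * (real (Suc k) / (real (Suc k) - x))) has_field_derivative
      hprod k x * ssum k x * (real (Suc k) / (real (Suc k) - x)) +
      real (Suc k) / (real (Suc k) - x)^2 * hprod k x) (at x)"
    using assms by (intro DERIV_mult Suc) (auto intro!: derivative_eq_intros simp: power2_eq_square)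
  moreover have "hprod k x * ssum k x * (real (Suc k) / (real (Suc k) - x)) +
      real (Suc k) / (real (Suc k) - x)^2 * hprod k x = hprod (Suc k) x * ssum (Suc k) x"
    by (simp add: hprod_Suc ssum_Suc power2_eq_square distrib_left add_divide_distrib mult_ac del: of_nat_Suc)
  ultimately show ?case by (simp add: hprod_Suc[abs_def] fun_eq_iff)
qed

text \<open>Termwise differentiation produces both the weight p + 1 and the shift from {1}^p to
  {1}^(p+1) in the zeta-star sum.\<close>

lemma Suc_hsym_sums:
  assumes "\<bar>x\<bar> < 1"
  shows "(\<lambda>p. (real (p + 1) * hsym (p + 1) k) * x ^ p) sums (hprod k x * ssum k x)"
  using termdiffs_sums_strong[of 1 "\<lambda>p. hsym p k" "hprod k", OF hsym_sums hprod_has_field_derivative] assms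
  by (simp add: diffs_def)

text \<open>Since 1 / (k (k - x)) is the sum of x^q / k^(q+2), multiplying by it realises the sum
  over p + q = N for a fixed outermost index k.\<close>

lemma convolution_geometric_sums:
  fixes a :: "nat \<Rightarrow> real"
  assumes x: "0 < x" "x < 1" and k: "k \<ge> 1" and a: "\<And>p. a p \<ge> 0" and s: "(\<lambda>p. a p * x ^ p) sums s"
  shows "(\<lambda>N. (\<Sum>p\<le>N. a p * (1 / real k ^ (N - p + 2))) * x ^ N) sums (s / (real k * (real k - x)))"
proof -
  have nx: "norm (x / real k) < 1" using x k by (simp add: field_simps)
  have g: "summable (\<lambda>q. norm ((1 / real k ^ 2) * (x / real k) ^ q))"
    unfolding norm_mult norm_power by (intro summable_mult summable_geometric) (use nx in auto)
  have "(\<lambda>N. \<Sum>p\<le>N. (a p * x ^ p) * ((1 / real k ^ 2) * (x / real k) ^ (N - p))) sums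
     ((\<Sum>p. a p * x ^ p) * (\<Sum>q. (1 / real k ^ 2) * (x / real k) ^ q))"
    by (rule Cauchy_product_sums[OF _ g]) (use s a x in \<open>auto simp: sums_iff abs_mult\<close>)
  also have "(\<Sum>p. a p * x ^ p) = s" using s by (simp add: sums_iff)
  also have "(\<Sum>q. (1 / real k ^ 2) * (x / real k) ^ q) = (1 / real k ^ 2) * (1 / (1 - x / real k))"
    by (subst suminf_mult[OF summable_geometric[OF nx]]) (simp add: suminf_geometric[OF nx])
  also have "\<dots> = 1 / (real k * (real k - x))" using x k by (simp add: field_simps power2_eq_square)
  also have "(\<lambda>N. \<Sum>p\<le>N. (a p * x ^ p) * ((1 / real k ^ 2) * (x / real k) ^ (N - p))) =
      (\<lambda>N. (\<Sum>p\<le>N. a p * (1 / real k ^ (N - p + 2))) * x ^ N)"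
  proof
    fix N
    show "(\<Sum>p\<le>N. (a p * x ^ p) * ((1 / real k ^ 2) * (x / real k) ^ (N - p))) =
      (\<Sum>p\<le>N. a p * (1 / real k ^ (N - p + 2))) * x ^ N"
      unfolding sum_distrib_right
    proof (intro sum.cong refl)
      fix p assume "p \<in> {..N}"
      hence "x ^ N = x ^ p * x ^ (N - p)" by (simp flip: power_add)
      thus "(a p * x ^ p) * ((1 / real k ^ 2) * (x / real k) ^ (N - p)) =
         a p * (1 / real k ^ (N - p + 2)) * x ^ N"
        by (simp add: power_add power_divide power2_eq_square mult_ac)
    qed
  qed
  finally show ?thesis by simp
qed

section \<open>Partial fractions and Beta values\<close>

text \<open>Vandermonde's convolution: compare coefficients in (1 - t)^(-a) (1 - t)^(-b) = (1 -
  t)^(-a-b).\<close>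

lemma pochhammer_fact_convolution:
  fixes a b :: real
  shows "(\<Sum>i\<le>n. (pochhammer a i / fact i) * (pochhammer b (n - i) / fact (n - i)))
       = pochhammer (a + b) n / fact n"
proof -
  have "(\<Sum>i\<le>n. (pochhammer a i / fact i) * (pochhammer b (n - i) / fact (n - i)))
     = (\<Sum>i\<le>n. real (n choose i) * pochhammer a i * pochhammer b (n - i) / fact n)"
    by (intro sum.cong refl) (auto simp: binomial_fact)
  thus ?thesis by (simp add: pochhammer_binomial_sum sum_divide_distrib)
qed

text \<open>The weight turns the second factor into minus a coefficient with parameter x - 1. The
  sum is then, up to sign, a Vandermonde convolution of total parameter 0 that lacks its last term,
  and that term is the right side.\<close>

lemma pochhammer_convolution_weighted:
  fixes x :: real
  shows "(\<Sum>i\<le>n. (pochhammer (1 - x) i / fact i) * (pochhammer x (n - i) / fact (n - i)) * ((1 - x) / real (Suc n - i)))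
       = pochhammer (1 - x) (Suc n) / fact (Suc n)"
proof -
  let ?v = "\<lambda>i. pochhammer (1 - x) i / fact i"
  have *: "(pochhammer x m / fact m) * ((1 - x) / real (Suc m)) = - (pochhammer (x - 1) (Suc m) / fact (Suc m))" for m
  proof -
    have "pochhammer (x - 1) (Suc m) = - ((1 - x) * pochhammer x m)"
      by (simp add: pochhammer_rec algebra_simps)
    thus ?thesis by (simp add: mult_ac)
  qed
  have "(\<Sum>i\<le>n. ?v i * (pochhammer x (n - i) / fact (n - i)) * ((1 - x) / real (Suc n - i)))
      = (\<Sum>i\<le>n. - (?v i * (pochhammer (x - 1) (Suc n - i) / fact (Suc n - i))))"
  proof (intro sum.cong refl)
    fix i assume "i \<in> {..n}"
    hence "Suc n - i = Suc (n - i)" by simp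
    thus "?v i * (pochhammer x (n - i) / fact (n - i)) * ((1 - x) / real (Suc n - i))
      = - (?v i * (pochhammer (x - 1) (Suc n - i) / fact (Suc n - i)))"
      by (simp only: mult.assoc * mult_minus_right)
  qed
  also have "\<dots> = ?v (Suc n) - (\<Sum>i\<le>Suc n. ?v i * (pochhammer (x - 1) (Suc n - i) / fact (Suc n - i)))"
    by (simp add: sum_negf)
  also have "\<dots> = ?v (Suc n)"
    by (subst pochhammer_fact_convolution) (simp add: pochhammer_0_left)
  finally show ?thesis .
qed

text \<open>Integrate the binomial series of (1 - t)^(-x) termwise against t^(a-1). All terms are
  nonnegative, so the Beta integrand itself dominates the partial sums.\<close>

lemma pochhammer_series_Beta:
  fixes x a :: real
  assumes x: "0 < x" "x < 1" and a: "a > 0"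
  shows "(\<lambda>m. (pochhammer x m / fact m) / (real m + a)) sums Beta a (1 - x)"
proof -
  let ?u = "\<lambda>m. pochhammer x m / fact m"
  let ?h = "\<lambda>t. t powr (a - 1) * (1 - t) powr (- x)"
  define f where "f = (\<lambda>n t. \<Sum>m<n. ?u m * t powr (real m + a - 1))"
  have u: "?u m \<ge> 0" for m using x by (simp add: pochhammer_nonneg)
  have h: "(?h has_integral Beta a (1 - x)) {0<..<1}"
    using has_integral_Beta_real[of a "1 - x"] x a by (simp add: has_integral_Icc_iff_Ioo)
  have pw: "(\<lambda>m. ?u m * t powr (real m + a - 1)) sums ?h t" if t: "t \<in> {0<..<1}" for t
  proof -
    have "(\<lambda>m. ((-x) gchoose m) * (-t) ^ m) sums (1 + (-t)) powr (-x)"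
      by (rule gen_binomial_real) (use t in auto)
    hence "(\<lambda>m. t powr (a - 1) * (((-x) gchoose m) * (-t) ^ m)) sums (t powr (a - 1) * (1 + (-t)) powr (-x))"
      by (rule sums_mult)
    moreover have "t powr (a - 1) * (((-x) gchoose m) * (-t) ^ m) = ?u m * t powr (real m + a - 1)" for m
    proof -
      have "((-x) gchoose m) * (-t) ^ m = ?u m * t ^ m"
        unfolding gbinomial_pochhammer power_minus[of t] by (simp add: mult_ac flip: power_add mult_2_right)
      moreover have "t powr (real m + a - 1) = t ^ m * t powr (a - 1)"
        using t by (simp add: powr_realpow[symmetric] add_diff_eq flip: powr_add)
      ultimately show ?thesis by (simp add: mult_ac)
    qed
    ultimately show ?thesis by simp
  qed
  have f: "(f n has_integral (\<Sum>m<n. ?u m / (real m + a))) {0<..<1}" for n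
    unfolding f_def
  proof (intro has_integral_sum)
    fix m
    have "((\<lambda>t. t powr (real m + a - 1)) has_integral (1 powr (real m + a - 1 + 1) / (real m + a - 1 + 1))) {0..1}"
      by (rule has_integral_powr_from_0) (use a in auto)
    from has_integral_mult_right[OF this, of "?u m"]
    show "((\<lambda>t. ?u m * t powr (real m + a - 1)) has_integral ?u m / (real m + a)) {0<..<1}"
      by (simp add: has_integral_Icc_iff_Ioo)
  qed auto
  have "(\<lambda>n. integral {0<..<1} (f n)) \<longlonglongrightarrow> integral {0<..<1} ?h"
  proof (rule dominated_convergence(2))
    show "?h integrable_on {0<..<1}" "f n integrable_on {0<..<1}" for n using h f by blast+
    show "(\<lambda>n. f n t) \<longlonglongrightarrow> ?h t" if "t \<in> {0<..<1}" for t
      using pw[OF that] by (simp add: f_def sums_def)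
    show "norm (f n t) \<le> ?h t" if "t \<in> {0<..<1}" for n t
    proof -
      have "f n t \<le> ?h t" unfolding f_def sums_unique[OF pw[OF that]]
        using pw[OF that] by (intro sum_le_suminf mult_nonneg_nonneg u) (auto simp: sums_iff)
      moreover have "f n t \<ge> 0" unfolding f_def by (intro sum_nonneg mult_nonneg_nonneg u) auto
      ultimately show ?thesis by simp
    qed
  qed
  thus ?thesis using integral_unique[OF f] integral_unique[OF h] by (simp add: sums_def)
qed

section \<open>Gamma quotients in place of infinite products\<close>

lemma pos_notin_nonpos_Ints: "z \<notin> \<int>\<^sub>\<le>\<^sub>0" if "z > 0" for z :: real
  using that by (auto elim!: nonpos_Ints_cases)

text \<open>Gauss's limit for Gamma, as \<open>Gamma_series\<close>, is substituted for each Gamma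
  value. The bound x < 1/2 keeps 1 - 2x positive. The claim is shown at Suc n because
  \<open>Gamma_series\<close> at n contains a Pochhammer symbol of length n + 1.\<close>

lemma Gamma_square_ratio_tendsto_1:
  fixes x :: real
  assumes x: "0 < x" "x < 1/2"
  shows "(\<lambda>k. Gamma (real k + 1 - x) ^ 2 / (fact k * Gamma (real k + 1 - 2 * x))) \<longlonglongrightarrow> 1"
proof -
  let ?L = "\<lambda>k. Gamma (real k + 1 - x) ^ 2 / (fact k * Gamma (real k + 1 - 2 * x))"
  have poch: "Gamma (real (Suc n) + z) = Gamma z * pochhammer z (n + 1)" if "z > 0" for z n
    using pochhammer_Gamma[OF pos_notin_nonpos_Ints[OF that], of "Suc n"] pos_notin_nonpos_Ints[OF that]
    by (simp add: add_ac Gamma_eq_zero_iff del: of_nat_Suc)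
  have gs: "pochhammer z (n + 1) = fact n * real n powr z / Gamma_series z n" if "z > 0" "n > 0" for z n
    using that by (simp add: Gamma_series_def powr_def)
  have G: "Gamma (1 - x) > 0" "Gamma (1 - 2*x) > 0" using x by (auto intro!: Gamma_real_pos)
  have "(\<lambda>n. Gamma (1 - x) ^ 2 / Gamma (1 - 2*x) * (real n / real (Suc n)) *
          (Gamma_series (1 - 2*x) n / Gamma_series (1 - x) n ^ 2)) \<longlonglongrightarrow>
      Gamma (1 - x) ^ 2 / Gamma (1 - 2*x) * 1 * (Gamma (1 - 2*x) / Gamma (1 - x) ^ 2)"
    using G by (intro tendsto_intros LIMSEQ_n_over_Suc_n) auto
  also have "Gamma (1 - x) ^ 2 / Gamma (1 - 2*x) * 1 * (Gamma (1 - 2*x) / Gamma (1 - x) ^ 2) = 1"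
    using G by simp
  finally have "(\<lambda>n. ?L (Suc n)) \<longlonglongrightarrow> 1"
  proof (rule Lim_transform_eventually)
    show "\<forall>\<^sub>F n in sequentially. Gamma (1 - x) ^ 2 / Gamma (1 - 2*x) * (real n / real (Suc n)) *
          (Gamma_series (1 - 2*x) n / Gamma_series (1 - x) n ^ 2) = ?L (Suc n)"
      using eventually_gt_at_top[of 0]
    proof eventually_elim
      case (elim n)
      \<comment> \<open>The powers of n cancel up to one factor n, which the n + 1 in (n + 1)!
        absorbs in the limit.\<close>
      have pw: "(real n powr (1 - x))^2 = real n * real n powr (1 - 2*x)"
        using elim powr_mult_base[of "real n" "1 - 2*x"] by (simp add: power2_eq_square flip: powr_add)
      have pos: "Gamma_series (1 - x) n > 0" "Gamma_series (1 - 2*x) n > 0"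
        using x elim by (auto simp: Gamma_series_def intro!: divide_pos_pos mult_pos_pos pochhammer_pos)
      have e1: "Gamma (real (Suc n) + 1 - x) = Gamma (1 - x) * (fact n * real n powr (1 - x) / Gamma_series (1 - x) n)"
        using poch[of "1 - x" n] gs[of "1 - x" n] x elim by (simp add: algebra_simps)
      have e2: "Gamma (real (Suc n) + 1 - 2*x) = Gamma (1 - 2*x) * (fact n * real n powr (1 - 2*x) / Gamma_series (1 - 2*x) n)"
        using poch[of "1 - 2*x" n] gs[of "1 - 2*x" n] x elim by (simp add: algebra_simps)
      have key: "g\<^sup>2 / g' * (real n / M) * (s' / s\<^sup>2) = (g * (f * real n powr (1 - x) / s))\<^sup>2
          / (M * f * (g' * (f * real n powr (1 - 2*x) / s')))"
        if "f > 0" "s > 0" "s' > 0" "g' > 0" "M > 0" for f s s' g g' M :: real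
        using that elim by (simp add: power_mult_distrib power_divide pw) (simp add: power2_eq_square mult_ac)
      have e3: "fact (Suc n) = real (Suc n) * fact n" by simp
      show ?case unfolding e1 e2 e3 by (rule key) (use pos G in auto)
    qed
  qed
  thus ?thesis by (rule LIMSEQ_imp_Suc)
qed

text \<open>\<open>A n i\<close> is the coefficient of 1 / (i + 1 - x - y) in the partial fractions
  of (1-y)...(n-y) / ((1-x-y)...(n+1-x-y)). The two claims are the value and the y-derivative of
  this expansion at y = 0.\<close>

lemma pochhammer_partial_fractions:
  fixes x :: real and n :: nat
  defines "A \<equiv> \<lambda>n i. (pochhammer (1 - x) i / fact i) * (pochhammer x (n - i) / fact (n - i))"
  assumes x: "0 < x" "x < 1"
  shows "(\<Sum>i\<le>n. A n i / (real i + 1 - x)) = hprod (Suc n) x / real (Suc n)" (is "?E n")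
    and "(\<Sum>i\<le>n. A n i / (real i + 1 - x) ^ 2) = hprod (Suc n) x / real (Suc n) * (ssum (Suc n) x - harm n)" (is "?D n")
proof -
  \<comment> \<open>Passing from n to n + 1 multiplies by (n+1-y) / (n+2-x-y). With p = i + 1 - x, q
    = n + 1 - i and c = 1 - x, \<open>pf1\<close> splits the new factor times an old pole at y = 0,
    and \<open>pf2\<close> is the y-derivative of \<open>pf1\<close> with p - y for p.\<close>
  have pf1: "(q - c) / q * (1 / p) + c / q * (1 / (p + q)) = (p + q - c) / (p + q) * (1 / p)"
    and pf2: "(q - c) / q * (1 / p ^ 2) + c / q * (1 / (p + q) ^ 2) =
          (p + q - c) / (p + q) * (1 / p ^ 2) - c / (p + q) ^ 2 * (1 / p)"
    if "p > 0" "q > 0" for p q c :: real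
  proof -
    have "p + q > 0" using that by simp
    with that show "(q - c) / q * (1 / p) + c / q * (1 / (p + q)) = (p + q - c) / (p + q) * (1 / p)"
      by (simp add: divide_simps) (simp add: algebra_simps)
    show "(q - c) / q * (1 / p ^ 2) + c / q * (1 / (p + q) ^ 2) =
          (p + q - c) / (p + q) * (1 / p ^ 2) - c / (p + q) ^ 2 * (1 / p)"
      using that \<open>p + q > 0\<close> by (simp add: divide_simps) (simp add: algebra_simps power2_eq_square)
  qed
  have e: "real i + 1 - x + real (Suc n - i) = real (Suc n) + 1 - x"
    "real (Suc n) + 1 - x - (1 - x) = real (Suc n)" if "i \<in> {..n}" for i n
    using that by (auto simp: of_nat_diff)
  \<comment> \<open>The coefficient at the new pole collects one contribution from each old
    pole.\<close>
  have diag: "A (Suc n) (Suc n) = (\<Sum>i\<le>n. A n i * ((1 - x) / real (Suc n - i)))" for n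
    using pochhammer_convolution_weighted[of x n] x by (simp add: A_def)
  have step: "A (Suc n) i = A n i * ((real (Suc n - i) - (1 - x)) / real (Suc n - i))" if "i \<le> n" for n i
    using that by (simp add: A_def Suc_diff_le pochhammer_Suc field_simps)
  have split: "(\<Sum>i\<le>Suc n. A (Suc n) i * f i) =
     (\<Sum>i\<le>n. A n i * ((real (Suc n - i) - (1 - x)) / real (Suc n - i) * f i +
           (1 - x) / real (Suc n - i) * f (Suc n)))" for n and f :: "nat \<Rightarrow> real"
  proof -
    have "(\<Sum>i\<le>Suc n. A (Suc n) i * f i) = (\<Sum>i\<le>n. A (Suc n) i * f i) + A (Suc n) (Suc n) * f (Suc n)"
      by simp
    also have "(\<Sum>i\<le>n. A (Suc n) i * f i) =
       (\<Sum>i\<le>n. A n i * ((real (Suc n - i) - (1 - x)) / real (Suc n - i)) * f i)"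
      by (intro sum.cong refl) (simp only: step atMost_iff)
    also have "\<dots> + A (Suc n) (Suc n) * f (Suc n) = (\<Sum>i\<le>n. A n i * ((real (Suc n - i) - (1 - x)) / real (Suc n - i)) * f i
        + A n i * ((1 - x) / real (Suc n - i)) * f (Suc n))"
      unfolding diag sum.distrib sum_distrib_right ..
    also have "\<dots> = (\<Sum>i\<le>n. A n i * ((real (Suc n - i) - (1 - x)) / real (Suc n - i) * f i +
           (1 - x) / real (Suc n - i) * f (Suc n)))"
      by (intro sum.cong refl) (simp only: distrib_left mult.assoc)
    finally show ?thesis .
  qed
  have E_Suc: "(\<Sum>i\<le>Suc n. A (Suc n) i / (real i + 1 - x)) =
      real (Suc n) / (real (Suc n) + 1 - x) * (\<Sum>i\<le>n. A n i / (real i + 1 - x))" for n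
  proof -
    have "(\<Sum>i\<le>Suc n. A (Suc n) i / (real i + 1 - x)) = (\<Sum>i\<le>Suc n. A (Suc n) i * (1 / (real i + 1 - x)))"
      by simp
    also have "\<dots> = (\<Sum>i\<le>n. A n i * (real (Suc n) / (real (Suc n) + 1 - x) * (1 / (real i + 1 - x))))"
      unfolding split
    proof (intro sum.cong refl arg_cong2[where f = "(*)"])
      fix i assume "i \<in> {..n}"
      thus "(real (Suc n - i) - (1 - x)) / real (Suc n - i) * (1 / (real i + 1 - x)) +
           (1 - x) / real (Suc n - i) * (1 / (real (Suc n) + 1 - x)) =
           real (Suc n) / (real (Suc n) + 1 - x) * (1 / (real i + 1 - x))"
        using pf1[of "real i + 1 - x" "real (Suc n - i)" "1 - x"] x unfolding e(1,2)[OF \<open>i \<in> {..n}\<close>] by simp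
    qed
    finally show ?thesis by (simp add: sum_distrib_left mult_ac)
  qed
  have D_Suc: "(\<Sum>i\<le>Suc n. A (Suc n) i / (real i + 1 - x) ^ 2) =
      real (Suc n) / (real (Suc n) + 1 - x) * (\<Sum>i\<le>n. A n i / (real i + 1 - x) ^ 2)
       - (1 - x) / (real (Suc n) + 1 - x) ^ 2 * (\<Sum>i\<le>n. A n i / (real i + 1 - x))" for n
  proof -
    have "(\<Sum>i\<le>Suc n. A (Suc n) i / (real i + 1 - x) ^ 2) = (\<Sum>i\<le>Suc n. A (Suc n) i * (1 / (real i + 1 - x) ^ 2))"
      by simp
    also have "\<dots> = (\<Sum>i\<le>n. A n i * (real (Suc n) / (real (Suc n) + 1 - x) * (1 / (real i + 1 - x) ^ 2)
           - (1 - x) / (real (Suc n) + 1 - x) ^ 2 * (1 / (real i + 1 - x))))"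
      unfolding split
    proof (intro sum.cong refl arg_cong2[where f = "(*)"])
      fix i assume "i \<in> {..n}"
      thus "(real (Suc n - i) - (1 - x)) / real (Suc n - i) * (1 / (real i + 1 - x) ^ 2) +
           (1 - x) / real (Suc n - i) * (1 / (real (Suc n) + 1 - x) ^ 2) =
           real (Suc n) / (real (Suc n) + 1 - x) * (1 / (real i + 1 - x) ^ 2)
           - (1 - x) / (real (Suc n) + 1 - x) ^ 2 * (1 / (real i + 1 - x))"
        using pf2[of "real i + 1 - x" "real (Suc n - i)" "1 - x"] x unfolding e(1,2)[OF \<open>i \<in> {..n}\<close>] by simp
    qed
    also have "\<dots> = (\<Sum>i\<le>n. real (Suc n) / (real (Suc n) + 1 - x) * (A n i / (real i + 1 - x) ^ 2)
           - (1 - x) / (real (Suc n) + 1 - x) ^ 2 * (A n i / (real i + 1 - x)))"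
      by (intro sum.cong refl) (simp add: right_diff_distrib mult_ac)
    finally show ?thesis by (simp only: sum_subtractf sum_distrib_left)
  qed
  have E: "?E n" for n
  proof (induction n)
    case 0
    show ?case by (simp add: A_def hprod_def)
  next
    case (Suc n)
    define N where "N = real (Suc n)"
    have N: "N > 0" "real (Suc (Suc n)) = N + 1" by (auto simp: N_def)
    show ?case unfolding E_Suc Suc hprod_Suc[of "Suc n"] N unfolding N_def[symmetric]
      using N(1) by simp
  qed
  have D: "?D n" for n
  proof (induction n)
    case 0
    show ?case by (simp add: A_def hprod_def ssum_def power2_eq_square harm_def)
  next
    case (Suc n)
    define h where "h = hprod (Suc n) x"
    define s where "s = ssum (Suc n) x - harm n"
    define N where "N = real (Suc n)"
    have N: "N > 0" "N + 1 - x > 0" "real (Suc (Suc n)) = N + 1" using x by (auto simp: N_def)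
    have 1: "hprod (Suc (Suc n)) x = h * ((N + 1) / (N + 1 - x))"
      by (simp only: hprod_Suc[of "Suc n"] h_def N)
    have 2: "ssum (Suc (Suc n)) x - harm (Suc n) = s + (1 / (N + 1 - x) - 1 / N)"
      unfolding ssum_Suc[of "Suc n"] harm_Suc s_def N N_def[symmetric] by (simp add: inverse_eq_divide)
    have "1 / (N + 1 - x) - 1 / N = - ((1 - x) / ((N + 1 - x) * N))"
      using N by (simp add: divide_simps)
    moreover have "N / P * (h / N * s) - c / P\<^sup>2 * (h / N) = h / P * (s + - (c / (P * N)))" for P c
      using N by (simp add: right_diff_distrib power2_eq_square mult_ac)
    moreover have "h * ((N + 1) / (N + 1 - x)) / (N + 1) = h / (N + 1 - x)" using N by simp
    ultimately have "N / (N + 1 - x) * (h / N * s) - (1 - x) / (N + 1 - x)\<^sup>2 * (h / N)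
        = h * ((N + 1) / (N + 1 - x)) / (N + 1) * (s + (1 / (N + 1 - x) - 1 / N))"
      by (simp only:)
    thus ?case unfolding D_Suc Suc E 1 2 N unfolding h_def[symmetric] s_def[symmetric] N_def[symmetric] .
  qed
  show "?E n" "?D n" by (rule E D)+
qed

text \<open>The closed form of the product of 1 - (x/(i-x))^2 = i (i - 2x) / (i - x)^2 over all i >
  k.\<close>

definition Gratio :: "real \<Rightarrow> nat \<Rightarrow> real" where
  "Gratio x k = Gamma (real k + 1 - x) ^ 2 / (fact k * Gamma (real k + 1 - 2 * x))"

lemma Gratio_pos: "0 < x \<Longrightarrow> x < 1/2 \<Longrightarrow> Gratio x k > 0"
  unfolding Gratio_def by (intro divide_pos_pos mult_pos_pos zero_less_power Gamma_real_pos) auto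

lemma Gratio_rec:
  assumes x: "0 < x" "x < 1/2"
  shows "Gratio x k = (1 - (x / (real (Suc k) - x)) ^ 2) * Gratio x (Suc k)"
proof -
  have 1: "Gamma (real (Suc k) + 1 - x) = (real (Suc k) - x) * Gamma (real k + 1 - x)"
    using Gamma_plus1[OF pos_notin_nonpos_Ints, of "real k + 1 - x"] x
    by (simp add: algebra_simps)
  have 2: "Gamma (real (Suc k) + 1 - 2 * x) = (real (Suc k) - 2 * x) * Gamma (real k + 1 - 2 * x)"
    using Gamma_plus1[OF pos_notin_nonpos_Ints, of "real k + 1 - 2 * x"] x
    by (simp add: algebra_simps)
  define N where "N = real (Suc k)"
  have N: "N > 0" "N - x > 0" "N - 2 * x > 0" using x by (auto simp: N_def)
  have "1 - (x / (N - x)) ^ 2 = N * (N - 2 * x) / (N - x) ^ 2"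
  proof -
    have "N * (N - 2 * x) = (N - x) ^ 2 - x ^ 2" by (simp add: power2_eq_square algebra_simps)
    thus ?thesis using N by (simp add: power_divide diff_divide_distrib)
  qed
  moreover have "fact (Suc k) = N * (fact k :: real)" by (simp add: N_def)
  ultimately show ?thesis using N
    unfolding Gratio_def 1 2 unfolding N_def[symmetric] by (simp add: power_mult_distrib)
qed

text \<open>The quotient of \<open>Q\<close> by \<open>Gratio x\<close> does not depend on k, and it
  tends to 1. This identifies the product with its expansion \<open>altsum\<close>.\<close>

lemma Gratio_unique:
  assumes x: "0 < x" "x < 1/2"
    and Q: "\<And>k. Q k = (1 - (x / (real (Suc k) - x)) ^ 2) * Q (Suc k)" and lim: "Q \<longlonglongrightarrow> 1"
  shows "Q k = Gratio x k"
proof -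
  have "Q (Suc k) / Gratio x (Suc k) = Q k / Gratio x k" for k
    using Q[of k] Gratio_rec[OF x, of k] Gratio_pos[OF x, of k] by auto
  hence const: "Q m / Gratio x m = Q 0 / Gratio x 0" for m by (induction m) auto
  have "(\<lambda>m. Q m / Gratio x m) \<longlonglongrightarrow> 1 / 1"
    unfolding Gratio_def by (intro tendsto_divide lim Gamma_square_ratio_tendsto_1 x) auto
  also have "(\<lambda>m. Q m / Gratio x m) = (\<lambda>_. Q 0 / Gratio x 0)" by (rule ext) (rule const)
  finally have "Q 0 / Gratio x 0 = 1" by (simp add: LIMSEQ_const_iff)
  thus ?thesis using const[of k] Gratio_pos[OF x, of k] by (simp add: field_simps)
qed

lemma Beta_eq_Gratio:
  assumes x: "0 < x" "x < 1/2"
  shows "(pochhammer (1 - x) i / fact i) * Beta (real i + 1 - x) (1 - x)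
       = real (Suc i) / (real (Suc i) - x) ^ 2 * Gratio x (Suc i)"
proof -
  have 1: "Gamma (real (Suc i) + 1 - x) = (real (Suc i) - x) * Gamma (real i + 1 - x)"
    using Gamma_plus1[OF pos_notin_nonpos_Ints, of "real i + 1 - x"] x
    by (simp add: algebra_simps)
  have 2: "pochhammer (1 - x) i = Gamma (real i + 1 - x) / Gamma (1 - x)"
    using pochhammer_Gamma[OF pos_notin_nonpos_Ints, of "1 - x" i] x by (simp add: algebra_simps)
  have 3: "Gamma (1 - x) > 0" using x by (intro Gamma_real_pos) auto
  have 4: "Beta (real i + 1 - x) (1 - x) = Gamma (real i + 1 - x) * Gamma (1 - x) / Gamma (real (Suc i) + 1 - 2 * x)"
    by (simp add: Beta_def algebra_simps)
  define N where "N = real (Suc i)"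
  have N: "N > 0" "N - x > 0" using x by (auto simp: N_def)
  have "fact (Suc i) = N * (fact i :: real)" by (simp add: N_def)
  thus ?thesis using 3 N
    unfolding Gratio_def 1 2 4 unfolding N_def[symmetric] by (simp add: power_mult_distrib power2_eq_square)
qed

text \<open>Term n of the given series is 1 / (n + 1 - x) times the sum with squared denominators.
  Putting n = i + m turns it into an antidiagonal sum of the nonnegative array \<open>t\<close>;
  summing over m first gives a Beta value for each i.\<close>

lemma hypergeometric_transformation:
  assumes x: "0 < x" "x < 1/2"
    and F: "((\<lambda>k. hprod k x * (ssum k x - harm (k - 1)) / (real k * (real k - x))) has_sum F) {0<..}"
  shows "((\<lambda>k. real k / (real k - x) ^ 4 * Gratio x k) has_sum F) {0<..}"
proof -
  define v where "v = (\<lambda>i. pochhammer (1 - x) i / fact i)"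
  define u where "u = (\<lambda>i. pochhammer x i / fact i)"
  define t where "t = (\<lambda>i m. v i * u m / (real i + 1 - x) ^ 2 / (real (i + m) + 1 - x))"
  have vu: "v i \<ge> 0" "u i \<ge> 0" for i using x by (auto simp: v_def u_def pochhammer_nonneg)
  have t0: "t i m \<ge> 0" for i m using x unfolding t_def
    by (intro divide_nonneg_nonneg mult_nonneg_nonneg vu) auto
  have "((\<lambda>n. \<Sum>i\<le>n. t i (n - i)) has_sum F) UNIV"
  proof (subst has_sum_reindex_bij_witness[where i = "\<lambda>k. k - 1" and j = Suc and T = "{0<..}"])
    show "((\<lambda>k. hprod k x * (ssum k x - harm (k - 1)) / (real k * (real k - x))) has_sum F) {0<..}" by fact
    fix n :: nat
    have "(\<Sum>i\<le>n. t i (n - i)) = (\<Sum>i\<le>n. v i * u (n - i) / (real i + 1 - x) ^ 2) / (real n + 1 - x)"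
      unfolding sum_divide_distrib t_def by (intro sum.cong) auto
    also have "\<dots> = hprod (Suc n) x / real (Suc n) * (ssum (Suc n) x - harm n) / (real n + 1 - x)"
      using pochhammer_partial_fractions(2)[of x n] x by (simp add: v_def u_def)
    finally show "hprod (Suc n) x * (ssum (Suc n) x - harm (Suc n - 1)) / (real (Suc n) * (real (Suc n) - x)) =
        (\<Sum>i\<le>n. t i (n - i))" by (simp add: algebra_simps)
  qed auto
  hence "((\<lambda>(n, i). t i (n - i)) has_sum F) (SIGMA n:UNIV. {..n})"
    by (intro has_sum_Sigma_nonneg) (auto intro!: has_sum_finite t0)
  also have "?this \<longleftrightarrow> ((\<lambda>(i, m). t i m) has_sum F) (UNIV \<times> UNIV)"
    by (rule has_sum_reindex_bij_witness[where j = "\<lambda>(n, i). (i, n - i)" and i = "\<lambda>(i, m). (i + m, i)"]) auto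
  finally have "((\<lambda>i. v i / (real i + 1 - x) ^ 2 * Beta (real i + 1 - x) (1 - x)) has_sum F) UNIV"
  proof (rule has_sum_SigmaD)
    fix i :: nat
    have "((\<lambda>m. u m / (real m + (real i + 1 - x))) has_sum Beta (real i + 1 - x) (1 - x)) UNIV"
    proof (rule sums_nonneg_imp_has_sum)
      show "(\<lambda>m. u m / (real m + (real i + 1 - x))) sums Beta (real i + 1 - x) (1 - x)"
        unfolding u_def by (rule pochhammer_series_Beta) (use x in auto)
      show "u m / (real m + (real i + 1 - x)) \<ge> 0" for m
        using x by (intro divide_nonneg_nonneg vu) auto
    qed
    from has_sum_cmult_right[OF this, of "v i / (real i + 1 - x) ^ 2"]
    show "((\<lambda>m. case (i, m) of (i, m) \<Rightarrow> t i m) has_sum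
        v i / (real i + 1 - x) ^ 2 * Beta (real i + 1 - x) (1 - x)) UNIV"
      by (simp add: t_def add_ac add_diff_eq)
  qed
  also have "?this \<longleftrightarrow> ?thesis"
  proof (rule has_sum_reindex_bij_witness[where j = Suc and i = "\<lambda>k. k - 1"])
    fix i
    have "v i / (real i + 1 - x) ^ 2 * Beta (real i + 1 - x) (1 - x)
       = real (Suc i) / (real (Suc i) - x) ^ 2 * Gratio x (Suc i) / (real (Suc i) - x) ^ 2"
      using Beta_eq_Gratio[OF x, of i, symmetric] by (simp add: v_def add_ac)
    thus "real (Suc i) / (real (Suc i) - x) ^ 4 * Gratio x (Suc i) =
        v i / (real i + 1 - x) ^ 2 * Beta (real i + 1 - x) (1 - x)"
      by (simp add: power_add[of _ 2 2, simplified] )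
  qed auto
  finally show ?thesis .
qed

section \<open>The left-hand side\<close>

text \<open>Multiplying out the product and keeping terms up to first order. Its use is to bound
  \<open>ssum\<close> by \<open>hprod / x\<close>, so that one growth estimate controls
  both.\<close>

lemma hprod_ge:
  assumes "0 < x" "x < 1"
  shows "1 + x * ssum k x \<le> hprod k x"
proof (induction k)
  case (Suc k)
  have s: "ssum k x \<ge> 0" using assms unfolding ssum_def by (intro sum_nonneg) auto
  have c: "real (Suc k) - x > 0" using assms by simp
  have "1 + x * ssum (Suc k) x \<le> (1 + x * ssum k x) * (1 + x / (real (Suc k) - x))"
  proof -
    have "x * ssum k x * (x / (real (Suc k) - x)) \<ge> 0" using s c assms by simp
    thus ?thesis unfolding ssum_Suc by (simp add: distrib_left distrib_right add_divide_distrib del: of_nat_Suc)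
  qed
  also have "1 + x / (real (Suc k) - x) = real (Suc k) / (real (Suc k) - x)"
    using c by (simp add: field_simps del: of_nat_Suc)
  also have "(1 + x * ssum k x) * \<dots> \<le> hprod (Suc k) x"
    unfolding hprod_Suc by (rule mult_right_mono[OF Suc]) (use c in simp)
  finally show ?case .
qed (simp add: hprod_def ssum_def)

text \<open>An integer power lets Bernoulli's inequality replace estimates of k^x; the fourth power
  is chosen so that \<open>hprod\<close> squared is at most the square root of k + 1.\<close>

lemma hprod_pow4_le:
  assumes "0 < x" "x \<le> 1/8"
  shows "hprod k x ^ 4 \<le> real (Suc k)"
proof (induction k)
  case (Suc k)
  define N where "N = real (Suc k)"
  have N: "N \<ge> 1" "real (Suc (Suc k)) = N + 1" by (auto simp: N_def)
  \<comment> \<open>From 4x <= 1/2 and N + 1 <= 2N.\<close>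
  have "4 * x * (N + 1) \<le> (1 / 2) * (N + 1)" using N assms by (intro mult_right_mono) auto
  also have "\<dots> \<le> N" using N by simp
  finally have "4 * x / N \<le> 1 / (N + 1)" using N by (simp add: field_simps)
  also have "\<dots> = 1 - N / (N + 1)" using N by (simp add: field_simps)
  finally have "N / (N + 1) \<le> 1 + real 4 * (- x / N)" by simp
  also have "\<dots> \<le> (1 + (- x / N)) ^ 4"
    by (rule Bernoulli_inequality) (use N assms in \<open>simp add: field_simps\<close>)
  also have "1 + (- x / N) = (N - x) / N" using N by (simp add: field_simps)
  finally have "N / (N + 1) \<le> ((N - x) / N) ^ 4" .
  hence "(N / (N - x)) ^ 4 \<le> (N + 1) / N" using N assms
    by (simp add: power_divide divide_simps mult_ac)
  hence "hprod k x ^ 4 * (N / (N - x)) ^ 4 \<le> N * ((N + 1) / N)"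
    using Suc N unfolding N_def[symmetric] by (intro mult_mono) auto
  thus ?case using N unfolding hprod_Suc power_mult_distrib N_def[symmetric] by simp
qed (simp add: hprod_def)

text \<open>The numerator is at most \<open>hprod\<close> squared over x, hence of order sqrt k, so
  the terms are of order k^(-3/2).\<close>

lemma hprod_ssum_summable:
  assumes x: "0 < x" "x \<le> 1/8"
  shows "(\<lambda>k. hprod k x * ssum k x / (real k * (real k - x))) summable_on {0<..}"
proof (rule summable_on_comparison_test)
  have "(\<lambda>k. real k powr (-3/2)) summable_on UNIV"
    by (rule summable_nonneg_imp_summable_on) (auto simp: summable_real_powr_iff)
  hence "(\<lambda>k. real k powr (-3/2)) summable_on {0<..}" by (rule summable_on_subset_banach) auto
  thus "(\<lambda>k. (4 / x) * real k powr (-3/2)) summable_on {0<..}" by (rule summable_on_cmult_right)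
  fix k :: nat assume "k \<in> {0<..}"
  hence k: "real k \<ge> 1" by auto
  have s: "ssum k x \<ge> 0" using x unfolding ssum_def by (intro sum_nonneg) auto
  have "1 \<le> 1 + x * ssum k x" using x s by simp
  also have "\<dots> \<le> hprod k x" by (rule hprod_ge) (use x in auto)
  finally have h: "hprod k x \<ge> 1" .
  show "hprod k x * ssum k x / (real k * (real k - x)) \<ge> 0" using h s k x by simp
  have "x * ssum k x \<le> hprod k x" using hprod_ge[of x k] x by linarith
  hence "hprod k x * (x * ssum k x) \<le> hprod k x * hprod k x" using h by (intro mult_left_mono) auto
  also have "\<dots> \<le> sqrt (real (Suc k))"
    using hprod_pow4_le[OF x, of k] by (intro real_le_rsqrt) (simp add: power_mult_distrib flip: power2_eq_square power_mult)
  also have "\<dots> \<le> sqrt (4 * real k)" using k by simp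
  also have "\<dots> = 2 * sqrt (real k)" by (simp add: real_sqrt_mult)
  finally have 1: "hprod k x * ssum k x \<le> 2 / x * sqrt (real k)" using x by (simp add: field_simps)
  have "real k * (real k - x) \<ge> real k * (real k / 2)" using k x by (intro mult_left_mono) auto
  hence "hprod k x * ssum k x / (real k * (real k - x)) \<le> (2 / x * sqrt (real k)) / (real k * (real k / 2))"
    using 1 k x by (intro frac_le) auto
  also have "\<dots> = (4 / x) * (real k powr (1/2) / real k powr 2)"
    using k by (simp add: powr_half_sqrt power2_eq_square)
  also have "\<dots> = (4 / x) * real k powr (-3/2)" unfolding powr_diff[symmetric] by simp
  finally show "hprod k x * ssum k x / (real k * (real k - x)) \<le> (4 / x) * real k powr (-3/2)" .
qed

text \<open>Stated for a general nonnegative array so as to serve both zeta-star and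
  \<open>G\<close>. Convergence of the single sums over k comes for free: each is dominated by a
  coefficient of the convergent total.\<close>

lemma coefficient_sums:
  fixes a :: "nat \<Rightarrow> nat \<Rightarrow> real"
  assumes x: "0 < x" "x < 1" and a: "\<And>k p. a k p \<ge> 0"
    and s: "\<And>k. k > 0 \<Longrightarrow> (\<lambda>p. a k p * x ^ p) sums s k"
    and F: "((\<lambda>k. s k / (real k * (real k - x))) has_sum F) {0<..}"
  shows "(\<lambda>k. a k p * (1 / real k ^ (q + 2))) summable_on {0<..}" (is ?summable)
    and "(\<lambda>N. (\<Sum>p\<le>N. \<Sum>\<^sub>\<infinity>k\<in>{0<..}. a k p * (1 / real k ^ (N - p + 2))) * x ^ N) sums F"
proof -
  define c where "c = (\<lambda>k N. (\<Sum>p\<le>N. a k p * (1 / real k ^ (N - p + 2))))"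
  have c0: "c k N \<ge> 0" for k N unfolding c_def by (intro sum_nonneg mult_nonneg_nonneg a) auto
  have row: "((\<lambda>N. c k N * x ^ N) has_sum s k / (real k * (real k - x))) UNIV" if "k \<in> {0<..}" for k
    unfolding c_def
    by (rule sums_nonneg_imp_has_sum[OF convolution_geometric_sums])
       (use x a s that c0 in \<open>auto simp: c_def\<close>)
  have "(\<lambda>k. c k N * x ^ N) summable_on {0<..}" for N
    by (rule summable_on_swap_nonneg[OF row F]) (use c0 x in auto)
  hence col: "(\<lambda>k. c k N) summable_on {0<..}" for N
    using x by (subst (asm) summable_on_cmult_left') auto
  have summable: "(\<lambda>k. a k p * (1 / real k ^ (q + 2))) summable_on {0<..}" for p q
  proof (rule summable_on_comparison_test[OF col[of "p + q"]])
    fix k :: nat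
    show "a k p * (1 / real k ^ (q + 2)) \<ge> 0" by (intro mult_nonneg_nonneg a) auto
    \<comment> \<open>One term of the convolution of degree p + q.\<close>
    have "a k p * (1 / real k ^ (p + q - p + 2)) \<le> c k (p + q)"
      unfolding c_def by (rule member_le_sum) (auto intro!: mult_nonneg_nonneg divide_nonneg_nonneg a)
    thus "a k p * (1 / real k ^ (q + 2)) \<le> c k (p + q)" by simp
  qed
  thus ?summable .
  have "((\<lambda>k. c k N) has_sum (\<Sum>p\<le>N. \<Sum>\<^sub>\<infinity>k\<in>{0<..}. a k p * (1 / real k ^ (N - p + 2)))) {0<..}" for N
    unfolding c_def by (intro has_sum_sum has_sum_infsum summable)
  hence "((\<lambda>N. (\<Sum>p\<le>N. \<Sum>\<^sub>\<infinity>k\<in>{0<..}. a k p * (1 / real k ^ (N - p + 2))) * x ^ N) has_sum F) UNIV"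
    by (intro has_sum_swap_nonneg[OF row F]) (use c0 x in \<open>auto intro!: has_sum_cmult_left\<close>)
  thus "(\<lambda>N. (\<Sum>p\<le>N. \<Sum>\<^sub>\<infinity>k\<in>{0<..}. a k p * (1 / real k ^ (N - p + 2))) * x ^ N) sums F"
    by (rule has_sum_imp_sums)
qed

lemma mzsv_ones_eq_infsum:
  assumes "(\<lambda>k. hsym p k * (1 / real k ^ m)) summable_on {0<..}"
  shows "mzsv (replicate p 1 @ [m]) = (\<Sum>\<^sub>\<infinity>k\<in>{0<..}. hsym p k * (1 / real k ^ m))"
proof -
  define L where "L = (\<lambda>k. {ls. length ls = p \<and> sorted ls \<and> (\<forall>l\<in>set ls. 1 \<le> l \<and> l \<le> (k::nat))})"
  define S where "S = (\<Sum>\<^sub>\<infinity>k\<in>{0<..}. hsym p k * (1 / real k ^ m))"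
  have "((\<lambda>k. hsym p k * (1 / real k ^ m)) has_sum S) {0<..}"
    unfolding S_def by (rule has_sum_infsum[OF assms])
  hence "((\<lambda>(k, ls). (\<Prod>i<p. 1 / real (ls ! i)) * (1 / real k ^ m)) has_sum S) (SIGMA k:{0<..}. L k)"
    by (rule has_sum_Sigma_nonneg[rotated])
       (auto simp: hsym_def L_def sum_divide_distrib intro!: has_sum_finiteI finite_sorted_lists[simplified]
          prod_nonneg divide_nonneg_nonneg)
  also have "?this \<longleftrightarrow> ((\<lambda>ks. \<Prod>i<length (replicate p 1 @ [m]). 1 / real (ks ! i) ^ ((replicate p 1 @ [m]) ! i)) has_sum S)
     {ks. length ks = length (replicate p 1 @ [m]) \<and> sorted ks \<and> (\<forall>k\<in>set ks. 1 \<le> k)}"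
  proof (rule has_sum_reindex_bij_witness[where j = "\<lambda>(k, ls). ls @ [k]" and i = "\<lambda>ks. (last ks, butlast ks)"])
    fix z assume z: "z \<in> (SIGMA k:{0<..}. L k)"
    obtain k ls where zk: "z = (k, ls)" by force
    have l: "length ls = p" using z zk by (auto simp: L_def)
    show "(\<Prod>i<length (replicate p 1 @ [m]). 1 / real ((case z of (k, ls) \<Rightarrow> ls @ [k]) ! i) ^ ((replicate p 1 @ [m]) ! i))
       = (case z of (k, ls) \<Rightarrow> (\<Prod>i<p. 1 / real (ls ! i)) * (1 / real k ^ m))"
      using l by (simp add: zk nth_append)
    show "(case z of (k, ls) \<Rightarrow> ls @ [k]) \<in> {ks. length ks = length (replicate p 1 @ [m]) \<and> sorted ks \<and> (\<forall>k\<in>set ks. 1 \<le> k)}"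
      using z zk by (auto simp: L_def sorted_append)
  next
    fix ks :: "nat list" assume ks: "ks \<in> {ks. length ks = length (replicate p 1 @ [m]) \<and> sorted ks \<and> (\<forall>k\<in>set ks. 1 \<le> k)}"
    then obtain ls k where lk: "ks = ls @ [k]" by (cases ks rule: rev_cases) auto
    show "(last ks, butlast ks) \<in> (SIGMA k:{0<..}. L k)"
      using ks lk by (auto simp: L_def sorted_append)
    show "(case (last ks, butlast ks) of (k, ls) \<Rightarrow> ls @ [k]) = ks" using lk by simp
  qed auto
  finally show ?thesis unfolding mzsv_def S_def[symmetric] by (rule infsumI)
qed

text \<open>The one index strictly below k contributes \<open>harm (k - 1)\<close>, which is an
  empty sum for k = 1.\<close>

lemma G_1_eq_infsum:
  assumes "(\<lambda>k. (harm (k - 1) * hsym p k) * (1 / real k ^ m)) summable_on {0<..}"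
  shows "G m 1 p = (\<Sum>\<^sub>\<infinity>k\<in>{0<..}. (harm (k - 1) * hsym p k) * (1 / real k ^ m))"
proof -
  define S where "S = (\<Sum>\<^sub>\<infinity>k\<in>{0<..}. (harm (k - 1) * hsym p k) * (1 / real k ^ m))"
  have "((\<lambda>k. (harm (k - 1) * hsym p k) * (1 / real k ^ m)) has_sum S) {0<..}"
    unfolding S_def by (rule has_sum_infsum[OF assms])
  hence "((\<lambda>(k, l). (1 / real l) * (1 / real k ^ m) * hsym p k) has_sum S) (SIGMA k:{0<..}. {1..k-1})"
    by (rule has_sum_Sigma_nonneg[rotated])
       (auto simp: harm_def sum_distrib_left sum_divide_distrib inverse_eq_divide mult_ac hsym_nonneg intro!: has_sum_finiteI)
  also have "?this \<longleftrightarrow> ((\<lambda>ks. (\<Prod>i<1. 1 / real (ks ! i)) * (1 / real (ks ! 1) ^ m) * hsym p (ks ! 1)) has_sum S)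
     {ks. length ks = 1 + 1 \<and> sorted_wrt (<) ks \<and> (\<forall>k\<in>set ks. 1 \<le> k)}"
    by (rule has_sum_reindex_bij_witness[where j = "\<lambda>(k, l). [l, k]" and i = "\<lambda>ks. (ks ! 1, ks ! 0)"])
       (auto simp: length_Suc_conv numeral_2_eq_2)
  finally show ?thesis unfolding S_def[symmetric] unfolding G_def hsym_def by (rule infsumI)
qed

text \<open>The zeta-star part and the \<open>G\<close> part are summed separately, because each has
  nonnegative terms; the second converges by comparison, as \<open>harm (k - 1)\<close> is at most
  \<open>ssum k x\<close>.\<close>

lemma left_side_generating_function:
  assumes x: "0 < x" "x \<le> 1/8"
  obtains F where
    "((\<lambda>k. hprod k x * (ssum k x - harm (k - 1)) / (real k * (real k - x))) has_sum F) {0<..}"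
    "(\<lambda>N. ((\<Sum>p\<le>N. real (p + 1) * mzsv (replicate (p + 1) 1 @ [(N - p) + 2]))
       - (\<Sum>p\<le>N. G ((N - p) + 2) 1 p)) * x ^ N) sums F"
proof -
  let ?H = "\<lambda>k. hprod k x * ssum k x / (real k * (real k - x))"
  let ?K = "\<lambda>k. hprod k x * harm (k - 1) / (real k * (real k - x))"
  have x1: "x < 1" "\<bar>x\<bar> < 1" using x by auto
  obtain F1 where F1: "(?H has_sum F1) {0<..}"
    using hprod_ssum_summable[OF x] by (auto simp: summable_on_def)
  have "?K summable_on {0<..}"
  proof (rule summable_on_comparison_test[OF hprod_ssum_summable[OF x]])
    fix k :: nat assume "k \<in> {0<..}"
    hence k: "real k \<ge> 1" by auto
    have h: "hprod k x \<ge> 0" unfolding hprod_def using x by (intro prod_nonneg) auto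
    show "?K k \<ge> 0" using h k x by (auto intro!: divide_nonneg_nonneg mult_nonneg_nonneg harm_nonneg)
    have "harm (k - 1) \<le> (harm k :: real)" by (rule harm_mono) auto
    also have "\<dots> \<le> ssum k x" unfolding harm_def ssum_def
      by (rule sum_mono) (use x in \<open>auto simp: field_simps\<close>)
    finally show "?K k \<le> ?H k" using h k x by (auto intro!: divide_right_mono mult_left_mono)
  qed
  then obtain F2 where F2: "(?K has_sum F2) {0<..}" by (auto simp: summable_on_def)
  note A = coefficient_sums[of x "\<lambda>k p. real (p + 1) * hsym (p + 1) k", OF x(1) x1(1) _ Suc_hsym_sums[OF x1(2)] F1]
  have "(\<lambda>p. (harm (k - 1) * hsym p k) * x ^ p) sums (hprod k x * harm (k - 1))" for k
    using sums_mult[OF hsym_sums[OF x1(2), of k], of "harm (k - 1)"] by (simp add: mult_ac)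
  note B = coefficient_sums[of x "\<lambda>k p. harm (k - 1) * hsym p k", OF x(1) x1(1) _ this F2]
  have m: "real (p + 1) * mzsv (replicate (p + 1) 1 @ [q + 2]) =
     (\<Sum>\<^sub>\<infinity>k\<in>{0<..}. real (p + 1) * hsym (p + 1) k * (1 / real k ^ (q + 2)))" for p q
  proof -
    have "(\<lambda>k. real (p + 1) * (hsym (p + 1) k * (1 / real k ^ (q + 2)))) summable_on {0<..}"
      using A(1)[of p q] by (simp add: hsym_nonneg mult.assoc)
    hence "(\<lambda>k. hsym (p + 1) k * (1 / real k ^ (q + 2))) summable_on {0<..}"
      by (subst (asm) summable_on_cmult_right') auto
    from mzsv_ones_eq_infsum[OF this] show ?thesis
      by (simp only: mult.assoc infsum_cmult_right')
  qed
  have g: "G (q + 2) 1 p = (\<Sum>\<^sub>\<infinity>k\<in>{0<..}. harm (k - 1) * hsym p k * (1 / real k ^ (q + 2)))" for p q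
    using B(1)[of p q] by (intro G_1_eq_infsum) (simp add: hsym_nonneg harm_nonneg)
  show thesis
  proof (rule that)
    show "((\<lambda>k. hprod k x * (ssum k x - harm (k - 1)) / (real k * (real k - x))) has_sum (F1 - F2)) {0<..}"
      using has_sum_add[OF F1 has_sum_cmult_right[OF F2, of "-1"]] by (simp add: right_diff_distrib diff_divide_distrib)
    show "(\<lambda>N. ((\<Sum>p\<le>N. real (p + 1) * mzsv (replicate (p + 1) 1 @ [(N - p) + 2]))
       - (\<Sum>p\<le>N. G ((N - p) + 2) 1 p)) * x ^ N) sums (F1 - F2)"
      unfolding m g left_diff_distrib
      by (intro sums_diff A(2) B(2)) (auto simp: hsym_nonneg harm_nonneg)
  qed
qed

section \<open>Tails of multiple zeta values and the right-hand side\<close>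

text \<open>The common majorant for all tails below; its exact value keeps the decay 1 / (k +
  1).\<close>

lemma has_sum_telescope_tail:
  "((\<lambda>l. 1 / (real l * (real l + 1))) has_sum 1 / (real k + 1)) {k<..}"
proof -
  have "(\<lambda>n. 1 / (real n + (real k + 1)) - 1 / (real (Suc n) + (real k + 1))) sums
      (1 / (real 0 + (real k + 1)) - 0)"
  proof (rule telescope_sums')
    show "(\<lambda>n. 1 / (real n + (real k + 1))) \<longlonglongrightarrow> 0"
      using LIMSEQ_ignore_initial_segment[OF LIMSEQ_inverse_real_of_nat, of k]
      by (simp add: inverse_eq_divide add_ac)
  qed
  moreover have "1 / (real n + (real k + 1)) - 1 / (real (Suc n) + (real k + 1)) =
      1 / (real (n + k + 1) * (real (n + k + 1) + 1))" for n
    by (simp add: divide_simps)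
  ultimately have "((\<lambda>n. 1 / (real (n + k + 1) * (real (n + k + 1) + 1))) has_sum 1 / (real k + 1)) UNIV"
    by (intro sums_nonneg_imp_has_sum) auto
  also have "?this \<longleftrightarrow> ?thesis"
    by (rule has_sum_reindex_bij_witness[where j = "\<lambda>n. n + k + 1" and i = "\<lambda>l. l - k - 1"]) auto
  finally show ?thesis .
qed

text \<open>The j-th elementary symmetric function of the numbers (x/(l-x))^2 over l > k, built from
  the smallest index upwards.\<close>

primrec tailsum :: "real \<Rightarrow> nat \<Rightarrow> nat \<Rightarrow> real" where
  "tailsum x 0 k = 1"
| "tailsum x (Suc j) k = (\<Sum>\<^sub>\<infinity>l\<in>{k<..}. (x / (real l - x)) ^ 2 * tailsum x j l)"

text \<open>Each factor is at most 4 x^2 / (l (l + 1)), and the tail of this telescopes. The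
  induction uses the bound uniform in k; the last claim retains 1 / (k + 1), which later yields the
  limit of \<open>altsum\<close>.\<close>

lemma
  assumes x: "0 < x" "x \<le> 1/8"
  shows tailsum_nonneg: "tailsum x j k \<ge> 0"
    and tailsum_le: "tailsum x j k \<le> (4 * x ^ 2) ^ j"
    and tailsum_summable: "(\<lambda>l. (x / (real l - x)) ^ 2 * tailsum x j l) summable_on {k<..}"
    and tailsum_Suc_le: "tailsum x (Suc j) k \<le> (4 * x ^ 2) ^ Suc j / (real k + 1)"
proof -
  define y where "y = 4 * x ^ 2"
  have y: "y \<ge> 0" by (simp add: y_def)
  have b: "(x / (real l - x)) ^ 2 \<le> y * (1 / (real l * (real l + 1)))" if "l > 0" for l :: nat
  proof -
    have l: "real l \<ge> 1" using that by simp
    \<comment> \<open>The factor 7/4 fits on both sides: its square exceeds 2, and 7l/4 <= 2(l - x)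
      for l >= 1 and x <= 1/8.\<close>
    have "real l * (real l + 1) \<le> (7/4 * real l)^2"
      using mult_left_mono[OF l, of "real l"] l by (simp add: power2_eq_square algebra_simps)
    also have "\<dots> \<le> (2 * (real l - x))^2" using l x by (intro power_mono) auto
    finally have "4 / (2 * (real l - x))^2 \<le> 4 / (real l * (real l + 1))"
      using l x by (intro divide_left_mono mult_pos_pos) auto
    hence "1 / (real l - x)^2 \<le> 4 / (real l * (real l + 1))"
      unfolding power_mult_distrib by simp
    from mult_left_mono[OF this, of "x^2"] show ?thesis by (simp add: power_divide y_def mult_ac)
  qed
  have step: "(\<lambda>l. (x / (real l - x)) ^ 2 * t l) summable_on {k<..} \<and>
     (\<Sum>\<^sub>\<infinity>l\<in>{k<..}. (x / (real l - x)) ^ 2 * t l) \<le> B * y / (real k + 1)"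
    if t: "\<And>l. 0 \<le> t l" "\<And>l. t l \<le> B" for t B k
  proof -
    have B: "B \<ge> 0" using t[of 0] by simp
    have le: "(x / (real l - x)) ^ 2 * t l \<le> (B * y) * (1 / (real l * (real l + 1)))" if "l \<in> {k<..}" for l
    proof -
      have "(x / (real l - x)) ^ 2 * t l \<le> (y * (1 / (real l * (real l + 1)))) * B"
        using that by (intro mult_mono b t mult_nonneg_nonneg y) auto
      thus ?thesis by (simp add: mult_ac)
    qed
    have maj: "((\<lambda>l. (B * y) * (1 / (real l * (real l + 1)))) has_sum (B * y) * (1 / (real k + 1))) {k<..}"
      by (intro has_sum_cmult_right has_sum_telescope_tail)
    have s: "(\<lambda>l. (x / (real l - x)) ^ 2 * t l) summable_on {k<..}"
      using has_sum_imp_summable[OF maj] le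
      by (rule summable_on_comparison_test) (auto intro!: mult_nonneg_nonneg t)
    show ?thesis using s has_sum_mono[OF has_sum_infsum[OF s] maj le] by simp
  qed
  have *: "0 \<le> tailsum x j k \<and> tailsum x j k \<le> y ^ j" for j k
  proof (induction j arbitrary: k)
    case (Suc j)
    have "tailsum x (Suc j) k \<le> y ^ j * y / (real k + 1)"
      using step[of "tailsum x j" "y ^ j" k] Suc by simp
    also have "\<dots> \<le> y ^ j * y / 1" using y by (intro divide_left_mono) auto
    finally have "tailsum x (Suc j) k \<le> y ^ Suc j" by (simp only: power_Suc2 div_by_1)
    moreover have "tailsum x (Suc j) k \<ge> 0"
      unfolding tailsum.simps using Suc by (intro infsum_nonneg mult_nonneg_nonneg) auto
    ultimately show ?case by blast
  qed auto
  show "tailsum x j k \<ge> 0" "tailsum x j k \<le> (4 * x ^ 2) ^ j"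
    using *[of j k] by (auto simp: y_def)
  show "(\<lambda>l. (x / (real l - x)) ^ 2 * tailsum x j l) summable_on {k<..}"
    "tailsum x (Suc j) k \<le> (4 * x ^ 2) ^ Suc j / (real k + 1)"
    using step[of "tailsum x j" "y ^ j" k] * unfolding tailsum.simps power_Suc2 y_def[symmetric] by auto
qed

lemma
  assumes x: "0 < x" "x \<le> 1/8"
  shows tailsum_le_geometric: "tailsum x j k \<le> (1 / 16) ^ j"
    and tailsum_Suc_le_geometric: "tailsum x (Suc j) k \<le> (1 / 16) ^ Suc j / (real k + 1)"
proof -
  have "x ^ 2 \<le> (1 / 8) ^ 2" using x by (intro power_mono) auto
  hence y: "4 * x ^ 2 \<le> 1 / 16" by (simp add: power2_eq_square)
  show "tailsum x j k \<le> (1 / 16) ^ j"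
    by (rule order_trans[OF tailsum_le[OF x] power_mono[OF y]]) auto
  show "tailsum x (Suc j) k \<le> (1 / 16) ^ Suc j / (real k + 1)"
    by (rule order_trans[OF tailsum_Suc_le[OF x] divide_right_mono[OF power_mono[OF y]]]) auto
qed

definition altsum :: "real \<Rightarrow> nat \<Rightarrow> real" where
  "altsum x k = (\<Sum>j. (-1) ^ j * tailsum x j k)"

lemma tailsum_summable_index:
  assumes x: "0 < x" "x \<le> 1/8"
  shows "summable (\<lambda>j. tailsum x j k)"
  by (rule summable_comparison_test'[of "\<lambda>j. (1 / 16) ^ j" 0])
     (use tailsum_le_geometric[OF x] tailsum_nonneg[OF x] in \<open>auto intro!: summable_geometric\<close>)

lemma altsum_sums:
  assumes x: "0 < x" "x \<le> 1/8"
  shows "(\<lambda>j. (-1) ^ j * tailsum x j k) sums altsum x k"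
proof -
  have "summable (\<lambda>j. norm ((-1) ^ j * tailsum x j k))"
    using tailsum_summable_index[OF x] tailsum_nonneg[OF x] by (simp add: abs_mult power_abs)
  thus ?thesis unfolding altsum_def by (rule summable_sums[OF summable_norm_cancel])
qed

text \<open>The index l = k + 1 either occurs in a term of \<open>tailsum\<close> or not; summed
  with signs, this pulls the first factor out of the product.\<close>

lemma altsum_rec:
  assumes x: "0 < x" "x \<le> 1/8"
  shows "altsum x k = (1 - (x / (real (Suc k) - x)) ^ 2) * altsum x (Suc k)"
proof -
  define b where "b = (x / (real (Suc k) - x)) ^ 2"
  have rec: "tailsum x (Suc j) k = b * tailsum x j (Suc k) + tailsum x (Suc j) (Suc k)" for j
  proof -
    have "{k<..} = insert (Suc k) {Suc k<..}" by auto
    thus ?thesis using tailsum_summable[OF x, of j "Suc k"]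
      by (simp add: infsum_insert b_def del: of_nat_Suc)
  qed
  have "(\<lambda>j. (-1) ^ Suc j * tailsum x (Suc j) (Suc k)) sums (altsum x (Suc k) - 1)"
    using altsum_sums[OF x, of "Suc k"]
      sums_Suc_iff[of "\<lambda>j. (-1) ^ j * tailsum x j (Suc k)" "altsum x (Suc k) - 1"] by simp
  from sums_add[OF sums_mult[OF altsum_sums[OF x, of "Suc k"], of "- b"] this]
  have "(\<lambda>j. (-1) ^ Suc j * tailsum x (Suc j) k) sums (- b * altsum x (Suc k) + (altsum x (Suc k) - 1))"
    unfolding rec by (simp add: algebra_simps del: tailsum.simps)
  hence "(\<lambda>j. (-1) ^ j * tailsum x j k) sums (- b * altsum x (Suc k) + (altsum x (Suc k) - 1) + 1)"
    using sums_Suc_iff[of "\<lambda>j. (-1) ^ j * tailsum x j k"] by simp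
  from sums_unique2[OF altsum_sums[OF x] this] show ?thesis by (simp add: b_def algebra_simps)
qed

lemma altsum_tendsto_1:
  assumes x: "0 < x" "x \<le> 1/8"
  shows "altsum x \<longlonglongrightarrow> 1"
proof -
  \<comment> \<open>The constant is the geometric sum of (1/16)^j over j >= 1.\<close>
  have bound: "norm (altsum x k - 1) \<le> (1 / 15) / (real k + 1)" for k
  proof -
    have "(\<lambda>j. (-1) ^ Suc j * tailsum x (Suc j) k) sums (altsum x k - 1)"
      using altsum_sums[OF x, of k]
        sums_Suc_iff[of "\<lambda>j. (-1) ^ j * tailsum x j k" "altsum x k - 1"] by simp
    moreover have "(\<lambda>j. (1 / 16) * (1 / 16) ^ j / (real k + 1)) sums ((1 / 16) * (1 / (1 - 1 / 16)) / (real k + 1))"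
      by (intro sums_divide sums_mult geometric_sums) auto
    moreover have "norm ((-1) ^ Suc j * tailsum x (Suc j) k) \<le> (1 / 16) * (1 / 16) ^ j / (real k + 1)" for j
      using tailsum_Suc_le_geometric[OF x, of j k] tailsum_nonneg[OF x, of "Suc j" k]
      by (simp add: abs_mult power_abs del: tailsum.simps)
    ultimately show ?thesis
      using norm_suminf_le[of "\<lambda>j. (-1) ^ Suc j * tailsum x (Suc j) k" "\<lambda>j. (1 / 16) * (1 / 16) ^ j / (real k + 1)"]
      unfolding sums_iff by simp
  qed
  have "(\<lambda>k. (1 / 15) / (real k + 1)) \<longlonglongrightarrow> 0"
    using tendsto_mult_right_zero[OF LIMSEQ_inverse_real_of_nat, of "1 / 15"]
    by (simp add: inverse_eq_divide add_ac)
  hence "(\<lambda>k. altsum x k - 1) \<longlonglongrightarrow> 0"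
    by (rule Lim_null_comparison[rotated]) (use bound in auto)
  thus ?thesis by (simp add: LIM_zero_iff)
qed

section \<open>Multiple zeta sums whose indices all exceed a bound k\<close>

primrec mzvtail :: "nat list \<Rightarrow> nat \<Rightarrow> real" where
  "mzvtail [] k = 1"
| "mzvtail (a # s) k = (\<Sum>\<^sub>\<infinity>l\<in>{k<..}. 1 / real l ^ a * mzvtail s l)"

text \<open>For a >= 2 and l >= 1, 1 / l^a is at most 2 / (l (l + 1)), whose tails sum to at most 2;
  each list entry costs one factor 2.\<close>

lemma mzvtail_bounds:
  assumes "\<forall>a\<in>set s. a \<ge> 2"
  shows "mzvtail s k \<ge> 0 \<and> mzvtail s k \<le> 2 ^ length s"
    and "a \<ge> 2 \<Longrightarrow> (\<lambda>l. 1 / real l ^ a * mzvtail s l) summable_on {k<..}"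
proof -
  have step: "(\<lambda>l. 1 / real l ^ a * t l) summable_on {k<..} \<and>
     (\<Sum>\<^sub>\<infinity>l\<in>{k<..}. 1 / real l ^ a * t l) \<le> B * 2"
    if t: "\<And>l. 0 \<le> t l" "\<And>l. t l \<le> B" and a: "a \<ge> 2" for t a B k
  proof -
    have B: "B \<ge> 0" using t[of 0] by simp
    have le: "1 / real l ^ a * t l \<le> (B * 2) * (1 / (real l * (real l + 1)))" if "l \<in> {k<..}" for l
    proof -
      have l: "real l \<ge> 1" using that by auto
      have "real l * (real l + 1) \<le> 2 * real l ^ 2"
        using mult_left_mono[OF l, of "real l"] l by (simp add: power2_eq_square algebra_simps)
      also have "\<dots> \<le> 2 * real l ^ a" using l a by (simp add: power_increasing)
      finally have "2 / (2 * real l ^ a) \<le> 2 / (real l * (real l + 1))"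
        using l by (intro divide_left_mono mult_pos_pos) auto
      hence "1 / real l ^ a \<le> 2 * (1 / (real l * (real l + 1)))" by simp
      hence "1 / real l ^ a * t l \<le> (2 * (1 / (real l * (real l + 1)))) * B"
        by (intro mult_mono t) auto
      thus ?thesis by (simp add: mult_ac)
    qed
    have maj: "((\<lambda>l. (B * 2) * (1 / (real l * (real l + 1)))) has_sum (B * 2) * (1 / (real k + 1))) {k<..}"
      by (intro has_sum_cmult_right has_sum_telescope_tail)
    have s: "(\<lambda>l. 1 / real l ^ a * t l) summable_on {k<..}"
      using has_sum_imp_summable[OF maj] le
      by (rule summable_on_comparison_test) (auto intro!: divide_nonneg_nonneg t)
    have "(B * 2) * (1 / (real k + 1)) \<le> (B * 2) * 1" using B by (intro mult_left_mono) auto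
    with s has_sum_mono[OF has_sum_infsum[OF s] maj le] show ?thesis by simp
  qed
  have *: "mzvtail s k \<ge> 0 \<and> mzvtail s k \<le> 2 ^ length s" if "\<forall>a\<in>set s. a \<ge> 2" for s k
    using that
  proof (induction s arbitrary: k)
    case (Cons a s)
    show ?case using step[of "mzvtail s" "2 ^ length s" a k] Cons by (auto intro!: infsum_nonneg)
  qed auto
  show "mzvtail s k \<ge> 0 \<and> mzvtail s k \<le> 2 ^ length s" using * assms by blast
  show "(\<lambda>l. 1 / real l ^ a * mzvtail s l) summable_on {k<..}" if "a \<ge> 2"
    using step[of "mzvtail s" "2 ^ length s" a k] *[of s] assms that by blast
qed

lemma mzvtail_has_sum:
  assumes "\<forall>a\<in>set s. a \<ge> 2"
  shows "((\<lambda>ks. \<Prod>i<length s. 1 / real (ks ! i) ^ (s ! i)) has_sum mzvtail s k)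
           {ks. length ks = length s \<and> sorted_wrt (<) ks \<and> (\<forall>l\<in>set ks. k < l)}"
  using assms
proof (induction s arbitrary: k)
  case Nil
  have L: "{ks. length ks = length [] \<and> sorted_wrt (<) ks \<and> (\<forall>l\<in>set ks. k < l)} = {[]}" by auto
  show ?case unfolding L by (rule has_sum_finiteI) simp_all
next
  case (Cons a s)
  let ?L = "\<lambda>s k. {ks. length ks = length s \<and> sorted_wrt (<) ks \<and> (\<forall>l\<in>set ks. k < l)}"
  have "((\<lambda>(l, ks). 1 / real l ^ a * (\<Prod>i<length s. 1 / real (ks ! i) ^ (s ! i))) has_sum mzvtail (a # s) k)
      (SIGMA l:{k<..}. ?L s l)"
  proof (rule has_sum_Sigma_nonneg)
    show "((\<lambda>l. 1 / real l ^ a * mzvtail s l) has_sum mzvtail (a # s) k) {k<..}"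
      unfolding mzvtail.simps
      by (rule has_sum_infsum, rule mzvtail_bounds(2)) (use Cons.prems in auto)
    show "((\<lambda>ks. case (l, ks) of (l, ks) \<Rightarrow> 1 / real l ^ a * (\<Prod>i<length s. 1 / real (ks ! i) ^ (s ! i))) has_sum
        1 / real l ^ a * mzvtail s l) (?L s l)" for l
      using has_sum_cmult_right[OF Cons.IH[of l], of "1 / real l ^ a"] Cons.prems by simp
  qed (auto intro!: mult_nonneg_nonneg divide_nonneg_nonneg prod_nonneg)
  also have "?this \<longleftrightarrow> ((\<lambda>ks. \<Prod>i<length (a # s). 1 / real (ks ! i) ^ ((a # s) ! i)) has_sum mzvtail (a # s) k) (?L (a # s) k)"
  proof (rule has_sum_reindex_bij_witness[where j = "\<lambda>(l, ks). l # ks" and i = "\<lambda>ks. (hd ks, tl ks)"])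
    fix ks assume "ks \<in> ?L (a # s) k"
    then obtain l ls where "ks = l # ls" "ks \<in> ?L (a # s) k" by (cases ks) auto
    thus "(hd ks, tl ks) \<in> (SIGMA l:{k<..}. ?L s l)"
      "(case (hd ks, tl ks) of (l, ks) \<Rightarrow> l # ks) = ks" by auto
  qed (auto simp: prod.lessThan_Suc_shift simp del: prod.lessThan_Suc)
  finally show ?case .
qed

lemma mzv_eq_mzvtail:
  assumes "\<forall>a\<in>set s. a \<ge> 2"
  shows "mzv s = mzvtail s 0"
  using infsumI[OF mzvtail_has_sum[OF assms, of 0]] unfolding mzv_def by (simp add: Suc_le_eq)

text \<open>The expansion step: for each index l both factors of a summand are series with
  nonnegative terms, and the sum over l is moved inside the sum over both expansion indices.\<close>

lemma has_sum_product_swap: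
  fixes X :: "'l \<Rightarrow> 'b \<Rightarrow> real" and Y :: "'l \<Rightarrow> 'c \<Rightarrow> real"
  assumes X: "\<And>l. l \<in> A \<Longrightarrow> (X l has_sum \<beta> l) B" "\<And>l b. l \<in> A \<Longrightarrow> X l b \<ge> 0"
    and Y: "\<And>l. l \<in> A \<Longrightarrow> (Y l has_sum \<tau> l) C" "\<And>l c. l \<in> A \<Longrightarrow> c \<in> C \<Longrightarrow> Y l c \<ge> 0"
    and S: "((\<lambda>l. \<beta> l * \<tau> l) has_sum S) A"
  shows "((\<lambda>(b, c). \<Sum>\<^sub>\<infinity>l\<in>A. X l b * Y l c) has_sum S) (B \<times> C)"
proof -
  have row: "((\<lambda>(b, c). X l b * Y l c) has_sum \<beta> l * \<tau> l) (B \<times> C)" if "l \<in> A" for l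
    by (rule has_sum_Sigma_nonneg[where g = "\<lambda>b. X l b * \<tau> l"])
       (use that X Y in \<open>auto intro!: has_sum_cmult_left has_sum_cmult_right\<close>)
  have nn: "(\<lambda>(b, c). X l b * Y l c) z \<ge> 0" if "l \<in> A" "z \<in> B \<times> C" for l z
    using that X Y by auto
  have "((\<lambda>l. (\<lambda>(b, c). X l b * Y l c) z) has_sum (\<lambda>(b, c). \<Sum>\<^sub>\<infinity>l\<in>A. X l b * Y l c) z) A" if "z \<in> B \<times> C" for z
    using summable_on_swap_nonneg[OF row S nn that] by (auto simp: case_prod_unfold)
  from has_sum_swap_nonneg[OF row S nn this] show ?thesis by simp
qed

text \<open>At r = x/l this expands (x/(l-x))^2: the source of the factors c + 1 in \<open>W\<close>
  and of the arguments c + 2.\<close>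

lemma power_series_inverse_square:
  fixes r :: real
  assumes "0 \<le> r" "r < 1"
  shows "((\<lambda>y. real (y + 1) * r ^ (y + 2)) has_sum (r / (1 - r)) ^ 2) UNIV"
proof (rule sums_nonneg_imp_has_sum)
  have "(\<lambda>y. r ^ 2 * (of_nat (Suc y) * r ^ y)) sums (r ^ 2 * (1 / (1 - r) ^ 2))"
    by (intro sums_mult geometric_deriv_sums) (use assms in auto)
  thus "(\<lambda>y. real (y + 1) * r ^ (y + 2)) sums (r / (1 - r)) ^ 2"
    by (simp add: power_divide power_add power2_eq_square mult_ac)
qed (use assms in auto)

text \<open>At r = x/l, and with a further l^(-3), this expands l/(l-x)^4: the source of the leading
  binomial in \<open>W\<close> and of the argument c + 3.\<close>

lemma power_series_inverse_pow4:
  fixes r :: real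
  assumes "0 \<le> r" "r < 1"
  shows "((\<lambda>y. real ((y + 3) choose 3) * r ^ y) has_sum 1 / (1 - r) ^ 4) UNIV"
proof (rule sums_nonneg_imp_has_sum)
  have "(\<lambda>y. ((-4) gchoose y) * (-r) ^ y) sums (1 + (-r)) powr (-4)"
    by (rule gen_binomial_real) (use assms in auto)
  moreover have "((-4) gchoose y) * (-r) ^ y = real ((y + 3) choose 3) * r ^ y" for y
  proof -
    have "(((-4)::real) gchoose y) = (-1) ^ y * ((4 + of_nat y - 1) gchoose y)"
      by (rule gbinomial_minus)
    also have "(4 + of_nat y - 1 :: real) gchoose y = real ((y + 3) choose y)"
      by (simp add: binomial_gbinomial add_ac)
    also have "(y + 3) choose y = (y + 3) choose 3" using binomial_symmetric[of 3 "y + 3"] by simp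
    finally show ?thesis unfolding power_minus[of r] by (simp add: mult_ac flip: power_add mult_2_right)
  qed
  moreover have "(1 + (-r)) powr (-4) = 1 / (1 - r) ^ 4"
    using assms by (simp add: powr_minus_divide)
  ultimately show "(\<lambda>y. real ((y + 3) choose 3) * r ^ y) sums (1 / (1 - r) ^ 4)" by simp
qed (use assms in auto)

lemma has_sum_lists_Suc:
  "(f has_sum S) {c. length c = Suc j} \<longleftrightarrow> ((\<lambda>(y, c). f (y # c)) has_sum S) (UNIV \<times> {c. length c = j})"
  by (rule has_sum_reindex_bij_witness[where i = "\<lambda>(y, c). y # c" and j = "\<lambda>c. (hd c, tl c)"])
     (auto simp: length_Suc_conv)

lemma tailsum_expansion:
  assumes x: "0 < x" "x \<le> 1/8"
  shows "((\<lambda>c. (\<Prod>y\<leftarrow>c. real (y + 1) * x ^ (y + 2)) * mzvtail (map (\<lambda>y. y + 2) c) k) has_sum tailsum x j k)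
           {c. length c = j}"
proof (induction j arbitrary: k)
  case 0
  show ?case by (rule has_sum_finiteI) auto
next
  case (Suc j)
  let ?w = "\<lambda>c. (\<Prod>y\<leftarrow>c. real (y + 1) * x ^ (y + 2))"
  let ?m = "\<lambda>c. mzvtail (map (\<lambda>y. y + 2) c)"
  have w: "?w c \<ge> 0" for c using x by (intro prod_list_nonneg) auto
  have m: "?m c l \<ge> 0" for c l using mzvtail_bounds(1)[of "map (\<lambda>y. y + 2) c"] by simp
  have "((\<lambda>(y, c). \<Sum>\<^sub>\<infinity>l\<in>{k<..}. (real (y + 1) * (x / real l) ^ (y + 2)) * (?w c * ?m c l)) has_sum tailsum x (Suc j) k)
     (UNIV \<times> {c. length c = j})"
  proof (rule has_sum_product_swap)
    show "((\<lambda>l. (x / (real l - x)) ^ 2 * tailsum x j l) has_sum tailsum x (Suc j) k) {k<..}"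
      using tailsum_summable[OF x] by simp
    fix l assume "l \<in> {k<..}"
    hence l: "real l \<ge> 1" by auto
    have "((\<lambda>y. real (y + 1) * (x / real l) ^ (y + 2)) has_sum (x / real l / (1 - x / real l)) ^ 2) UNIV"
      by (rule power_series_inverse_square) (use x l in auto)
    also have "x / real l / (1 - x / real l) = x / (real l - x)" using l x by (simp add: field_simps)
    finally show "((\<lambda>y. real (y + 1) * (x / real l) ^ (y + 2)) has_sum (x / (real l - x)) ^ 2) UNIV" .
    show "real (y + 1) * (x / real l) ^ (y + 2) \<ge> 0" for y using x by simp
    show "((\<lambda>c. ?w c * ?m c l) has_sum tailsum x j l) {c. length c = j}" by (rule Suc)
    show "?w c * ?m c l \<ge> 0" for c by (intro mult_nonneg_nonneg w m)
  qed
  moreover have "(\<Sum>\<^sub>\<infinity>l\<in>{k<..}. (real (y + 1) * (x / real l) ^ (y + 2)) * (?w c * ?m c l)) = ?w (y # c) * ?m (y # c) k" for y c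
  proof -
    have "(\<Sum>\<^sub>\<infinity>l\<in>{k<..}. (real (y + 1) * (x / real l) ^ (y + 2)) * (?w c * ?m c l))
      = (\<Sum>\<^sub>\<infinity>l\<in>{k<..}. ?w (y # c) * (1 / real l ^ (y + 2) * ?m c l))"
      by (intro infsum_cong) (simp add: power_divide mult_ac)
    also have "\<dots> = ?w (y # c) * (\<Sum>\<^sub>\<infinity>l\<in>{k<..}. 1 / real l ^ (y + 2) * ?m c l)"
      by (rule infsum_cmult_right')
    finally show ?thesis by (simp only: list.map mzvtail.simps)
  qed
  ultimately show ?case unfolding has_sum_lists_Suc by simp
qed

text \<open>The head of c carries x^y and each of the j other entries x^(y+2), which accounts for
  the exponent of x.\<close>

lemma right_side_fixed_depth:
  assumes x: "0 < x" "x \<le> 1/8"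
    and R: "((\<lambda>l. real l / (real l - x) ^ 4 * tailsum x j l) has_sum R) {0<..}"
  shows "((\<lambda>c. x ^ (sum_list c + 2 * j) * (mzv ((hd c + 3) # map (\<lambda>y. y + 2) (tl c)) * W c)) has_sum R)
           {c. length c = Suc j}"
proof -
  let ?w = "\<lambda>c. (\<Prod>y\<leftarrow>c. real (y + 1) * x ^ (y + 2))"
  let ?m = "\<lambda>c. mzvtail (map (\<lambda>y. y + 2) c)"
  have w: "?w c \<ge> 0" for c using x by (intro prod_list_nonneg) auto
  have m: "?m c l \<ge> 0" for c l using mzvtail_bounds(1)[of "map (\<lambda>y. y + 2) c"] by simp
  have weq: "?w c = x ^ (sum_list c + 2 * length c) * (\<Prod>y\<leftarrow>c. real (y + 1))" for c
    by (induction c) (auto simp: power_add mult_ac)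
  have "((\<lambda>(y, c). \<Sum>\<^sub>\<infinity>l\<in>{0<..}. (real ((y + 3) choose 3) * (x / real l) ^ y / real l ^ 3) * (?w c * ?m c l)) has_sum R)
     (UNIV \<times> {c. length c = j})"
  proof (rule has_sum_product_swap[OF _ _ _ _ R])
    fix l :: nat assume "l \<in> {0<..}"
    hence l: "real l \<ge> 1" by auto
    have "((\<lambda>y. (real ((y + 3) choose 3) * (x / real l) ^ y) * (1 / real l ^ 3)) has_sum
         1 / (1 - x / real l) ^ 4 * (1 / real l ^ 3)) UNIV"
      by (intro has_sum_cmult_left power_series_inverse_pow4) (use x l in auto)
    also have "1 - x / real l = (real l - x) / real l" using l by (simp add: field_simps)
    also have "1 / ((real l - x) / real l) ^ 4 * (1 / real l ^ 3) = real l / (real l - x) ^ 4"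
      using l by (simp add: power_divide numeral_eq_Suc)
    finally show "((\<lambda>y. real ((y + 3) choose 3) * (x / real l) ^ y / real l ^ 3) has_sum real l / (real l - x) ^ 4) UNIV"
      by simp
    show "real ((y + 3) choose 3) * (x / real l) ^ y / real l ^ 3 \<ge> 0" for y using x by simp
    show "((\<lambda>c. ?w c * ?m c l) has_sum tailsum x j l) {c. length c = j}" by (rule tailsum_expansion[OF x])
    show "?w c * ?m c l \<ge> 0" for c by (intro mult_nonneg_nonneg w m)
  qed
  moreover have "(\<Sum>\<^sub>\<infinity>l\<in>{0<..}. (real ((y + 3) choose 3) * (x / real l) ^ y / real l ^ 3) * (?w c * ?m c l))
      = x ^ (sum_list (y # c) + 2 * j) * (mzv ((hd (y # c) + 3) # map (\<lambda>y. y + 2) (tl (y # c))) * W (y # c))"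
    if "length c = j" for y c
  proof -
    have "(\<Sum>\<^sub>\<infinity>l\<in>{0<..}. (real ((y + 3) choose 3) * (x / real l) ^ y / real l ^ 3) * (?w c * ?m c l))
      = (\<Sum>\<^sub>\<infinity>l\<in>{0<..}. (real ((y + 3) choose 3) * x ^ y * ?w c) * (1 / real l ^ (y + 3) * ?m c l))"
      by (intro infsum_cong) (simp add: power_divide power_add mult_ac)
    also have "\<dots> = (real ((y + 3) choose 3) * x ^ y * ?w c) * mzvtail ((y + 3) # map (\<lambda>y. y + 2) c) 0"
      unfolding mzvtail.simps by (rule infsum_cmult_right')
    also have "mzvtail ((y + 3) # map (\<lambda>y. y + 2) c) 0 = mzv ((y + 3) # map (\<lambda>y. y + 2) c)"
      by (rule mzv_eq_mzvtail[symmetric]) auto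
    finally show ?thesis unfolding weq W_def that
      by (simp only: list.sel sum_list.Cons power_add mult_ac)
  qed
  ultimately show ?thesis unfolding has_sum_lists_Suc
    by (subst has_sum_cong) (auto simp: case_prod_unfold)
qed

text \<open>The index lists of all depths j = \<open>length c - 1\<close> that contribute to x^N.
  Requiring c to be nonempty matters: with truncated subtraction the empty list would count in
  degree 0.\<close>

definition comps :: "nat \<Rightarrow> nat list set" where
  "comps N = {c. c \<noteq> [] \<and> sum_list c + 2 * (length c - 1) = N}"

lemma finite_comps: "finite (comps N)"
proof (rule finite_subset)
  show "comps N \<subseteq> {c. set c \<subseteq> {..N} \<and> length c \<le> N + 1}"
  proof
    fix c assume c: "c \<in> comps N"
    hence "sum_list c \<le> N" "length c \<le> N + 1" by (auto simp: comps_def)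
    moreover have "y \<le> sum_list c" if "y \<in> set c" for y using that by (intro member_le_sum_list) auto
    ultimately show "c \<in> {c. set c \<subseteq> {..N} \<and> length c \<le> N + 1}" by (auto intro: order_trans)
  qed
qed (rule finite_lists_length_le, simp)

text \<open>Because of the signs, Tonelli does not apply directly. Each rearrangement is first
  justified for the unsigned terms, and the signed sum then follows by absolute summability.\<close>

lemma right_side_generating_function:
  assumes x: "0 < x" "x \<le> 1/8"
    and F: "((\<lambda>l. real l / (real l - x) ^ 4 * altsum x l) has_sum F) {0<..}"
  shows "(\<lambda>N. (\<Sum>c\<in>comps N. (-1) ^ (length c - 1) *
            (mzv ((hd c + 3) # map (\<lambda>y. y + 2) (tl c)) * W c)) * x ^ N) sums F"
proof -
  define \<beta> where "\<beta> = (\<lambda>l. real l / (real l - x) ^ 4)"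
  define R where "R = (\<lambda>j. \<Sum>\<^sub>\<infinity>l\<in>{0<..}. \<beta> l * tailsum x j l)"
  have T0: "tailsum x j l \<ge> 0" for j l by (rule tailsum_nonneg[OF x])
  have \<beta>0: "\<beta> l \<ge> 0" for l by (simp add: \<beta>_def)
  have \<beta>: "\<beta> summable_on {0<..}"
  proof (rule summable_on_comparison_test)
    show "(\<lambda>l. 32 * (1 / (real l * (real l + 1)))) summable_on {0<..}"
      using has_sum_imp_summable[OF has_sum_telescope_tail[of 0]] by (rule summable_on_cmult_right)
    fix l :: nat assume "l \<in> {0<..}"
    hence l: "real l \<ge> 1" by auto
    \<comment> \<open>Here l - x >= l/2 gives 16 / l^3, and l + 1 <= 2 l^2 turns this into 32 times
      the telescoping majorant.\<close>
    have "(real l / 2) ^ 4 \<le> (real l - x) ^ 4" using l x by (intro power_mono) auto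
    hence "\<beta> l \<le> real l / (real l / 2) ^ 4" unfolding \<beta>_def using l x by (intro divide_left_mono mult_pos_pos) auto
    also have "\<dots> = 16 / real l ^ 3" using l by (simp add: power_divide numeral_eq_Suc)
    also have "\<dots> = 32 / (2 * real l ^ 3)" by simp
    also have "\<dots> \<le> 32 / (real l * (real l + 1))"
    proof (rule divide_left_mono)
      have "real l * (real l + 1) \<le> real l * (2 * real l ^ 2)"
      proof (rule mult_left_mono)
        have "real l * 1 \<le> real l * real l" using l by (intro mult_left_mono) auto
        thus "real l + 1 \<le> 2 * real l ^ 2" unfolding power2_eq_square using l by linarith
      qed auto
      thus "real l * (real l + 1) \<le> 2 * real l ^ 3" by (simp add: numeral_eq_Suc mult_ac)
    qed (use l in auto)
    finally show "\<beta> l \<le> 32 * (1 / (real l * (real l + 1)))" by simp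
  qed (rule \<beta>0)
  have abs_sum: "(\<lambda>(l, j). \<beta> l * tailsum x j l) summable_on {0<..} \<times> UNIV"
  proof (rule summable_on_SigmaI)
    show "((\<lambda>j. case (l, j) of (l, j) \<Rightarrow> \<beta> l * tailsum x j l) has_sum \<beta> l * (\<Sum>j. tailsum x j l)) UNIV" for l
      using tailsum_summable_index[OF x, of l]
      by (auto intro!: has_sum_cmult_right sums_nonneg_imp_has_sum T0 summable_sums)
    show "(\<lambda>l. \<beta> l * (\<Sum>j. tailsum x j l)) summable_on {0<..}"
    proof (rule summable_on_comparison_test)
      show "(\<lambda>l. \<beta> l * 2) summable_on {0<..}" by (rule summable_on_cmult_left[OF \<beta>])
      fix l
      have "(\<Sum>j. tailsum x j l) \<le> (\<Sum>j. (1 / 16) ^ j)"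
        using tailsum_summable_index[OF x, of l]
        by (intro suminf_le tailsum_le_geometric[OF x] summable_geometric) auto
      also have "\<dots> \<le> 2" by (subst suminf_geometric) auto
      finally show "\<beta> l * (\<Sum>j. tailsum x j l) \<le> \<beta> l * 2" by (intro mult_left_mono \<beta>0)
      show "\<beta> l * (\<Sum>j. tailsum x j l) \<ge> 0"
        using tailsum_summable_index[OF x, of l] by (intro mult_nonneg_nonneg \<beta>0 suminf_nonneg T0)
    qed
  qed (auto intro!: mult_nonneg_nonneg \<beta>0 T0)
  have swapped: "(\<lambda>(j, l). \<beta> l * tailsum x j l) summable_on UNIV \<times> {0<..}"
    using abs_sum by (subst summable_on_swap) (simp add: case_prod_unfold)
  have R: "((\<lambda>l. \<beta> l * tailsum x j l) has_sum R j) {0<..}" for j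
    unfolding R_def using summable_on_SigmaD1[OF swapped, of j] by simp
  \<comment> \<open>The unsigned depth sums are summable too; this is what later allows regrouping
    the lists by degree.\<close>
  have Rsum: "R summable_on UNIV"
    using has_sum_SigmaD[OF has_sum_infsum[OF swapped], of R] R by (auto simp: summable_on_def)
  have FR: "((\<lambda>j. (-1) ^ j * R j) has_sum F) UNIV"
  proof -
    have "((\<lambda>(l, j). \<beta> l * ((-1) ^ j * tailsum x j l)) has_sum F) ({0<..} \<times> UNIV)"
    proof (rule has_sum_SigmaI)
      show "((\<lambda>l. \<beta> l * altsum x l) has_sum F) {0<..}" using F by (simp add: \<beta>_def)
      show "((\<lambda>j. case (l, j) of (l, j) \<Rightarrow> \<beta> l * ((-1) ^ j * tailsum x j l)) has_sum \<beta> l * altsum x l) UNIV" for l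
        using altsum_sums[OF x, of l] tailsum_summable_index[OF x, of l] T0
        by (auto intro!: has_sum_cmult_right norm_summable_imp_has_sum simp: abs_mult power_abs)
      show "(\<lambda>(l, j). \<beta> l * ((-1) ^ j * tailsum x j l)) summable_on {0<..} \<times> UNIV"
        by (rule abs_summable_summable)
           (use abs_sum \<beta>0 T0 in \<open>simp add: case_prod_unfold abs_mult power_abs\<close>)
    qed
    hence "((\<lambda>(j, l). \<beta> l * ((-1) ^ j * tailsum x j l)) has_sum F) (UNIV \<times> {0<..})"
      by (subst has_sum_swap) (simp add: case_prod_unfold)
    thus ?thesis
    proof (rule has_sum_SigmaD)
      show "((\<lambda>l. case (j, l) of (j, l) \<Rightarrow> \<beta> l * ((-1) ^ j * tailsum x j l)) has_sum (-1) ^ j * R j) {0<..}" for j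
        using has_sum_cmult_right[OF R[of j], of "(-1) ^ j"] by (simp add: mult_ac)
    qed
  qed
  define Z where "Z = (\<lambda>c. mzv ((hd c + 3) # map (\<lambda>y. y + 2) (tl c)) * W c)"
  have Z0: "Z c \<ge> 0" for c
  proof -
    have "W c \<ge> 0" unfolding W_def by (auto intro!: mult_nonneg_nonneg prod_list_nonneg)
    thus ?thesis using mzvtail_bounds(1)[of "(hd c + 3) # map (\<lambda>y. y + 2) (tl c)" 0]
        mzv_eq_mzvtail[of "(hd c + 3) # map (\<lambda>y. y + 2) (tl c)"] by (simp add: Z_def)
  qed
  have depth: "((\<lambda>c. x ^ (sum_list c + 2 * j) * Z c) has_sum R j) {c. length c = Suc j}" for j
    unfolding Z_def by (rule right_side_fixed_depth[OF x]) (use R[of j] in \<open>simp add: \<beta>_def\<close>)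
  have "((\<lambda>(j, c). (-1) ^ j * (x ^ (sum_list c + 2 * j) * Z c)) has_sum F) (SIGMA j:UNIV. {c. length c = Suc j})"
  proof (rule has_sum_SigmaI[OF _ FR])
    show "((\<lambda>c. case (j, c) of (j, c) \<Rightarrow> (-1) ^ j * (x ^ (sum_list c + 2 * j) * Z c)) has_sum (-1) ^ j * R j)
        {c. length c = Suc j}" for j
      using has_sum_cmult_right[OF depth[of j], of "(-1) ^ j"] by simp
    have "(\<lambda>(j, c). x ^ (sum_list c + 2 * j) * Z c) summable_on (SIGMA j:UNIV. {c. length c = Suc j})"
      by (rule summable_on_SigmaI[OF _ Rsum]) (use depth Z0 x in \<open>auto intro!: mult_nonneg_nonneg\<close>)
    moreover have "norm ((\<lambda>(j, c). (-1) ^ j * (x ^ (sum_list c + 2 * j) * Z c)) z) =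
        (\<lambda>(j, c). x ^ (sum_list c + 2 * j) * Z c) z" for z :: "nat \<times> nat list"
      using Z0 x by (cases z) (simp add: abs_mult power_abs)
    ultimately show "(\<lambda>(j, c). (-1) ^ j * (x ^ (sum_list c + 2 * j) * Z c)) summable_on (SIGMA j:UNIV. {c. length c = Suc j})"
      by (subst abs_summable_summable) simp_all
  qed
  also have "?this \<longleftrightarrow> ((\<lambda>(N, c). ((-1) ^ (length c - 1) * Z c) * x ^ N) has_sum F) (SIGMA N:UNIV. comps N)"
    by (rule has_sum_reindex_bij_witness[where j = "\<lambda>(j, c). (sum_list c + 2 * j, c)" and i = "\<lambda>(N, c). (length c - 1, c)"])
       (auto simp: comps_def mult_ac)
  finally have "((\<lambda>N. (\<Sum>c\<in>comps N. (-1) ^ (length c - 1) * Z c) * x ^ N) has_sum F) UNIV"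
    by (rule has_sum_SigmaD) (auto intro!: has_sum_finiteI finite_comps simp: sum_distrib_right)
  thus ?thesis unfolding Z_def by (rule has_sum_imp_sums)
qed

text \<open>Both coefficient sequences have the same generating function for 0 < x < 1/8, the link
  being that \<open>altsum\<close> satisfies the recurrence and limit that characterise
  \<open>Gratio\<close>.\<close>

lemma left_side_eq_sum_comps:
  "(\<Sum>p\<le>N. real (p + 1) * mzsv (replicate (p + 1) 1 @ [(N - p) + 2])) - (\<Sum>p\<le>N. G ((N - p) + 2) 1 p)
   = (\<Sum>c\<in>comps N. (-1) ^ (length c - 1) * (mzv ((hd c + 3) # map (\<lambda>y. y + 2) (tl c)) * W c))"
  (is "?l N = ?r N")
proof -
  have "?l N - ?r N = 0"
  proof (rule powser_coeffs_eq_0[of "1/8" "\<lambda>N. ?l N - ?r N"])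
    fix x :: real assume x: "0 < x" "x < 1/8"
    hence x': "x \<le> 1/8" "x < 1/2" by auto
    obtain F where F: "((\<lambda>k. hprod k x * (ssum k x - harm (k - 1)) / (real k * (real k - x))) has_sum F) {0<..}"
      and l: "(\<lambda>N. ?l N * x ^ N) sums F"
      using left_side_generating_function[OF x(1) x'(1)] by blast
    have "altsum x k = Gratio x k" for k
      by (rule Gratio_unique[OF x(1) x'(2) altsum_rec altsum_tendsto_1]) (use x x' in auto)
    hence "((\<lambda>l. real l / (real l - x) ^ 4 * altsum x l) has_sum F) {0<..}"
      using hypergeometric_transformation[OF x(1) x'(2) F] by simp
    from sums_diff[OF l right_side_generating_function[OF x(1) x'(1) this]]
    show "(\<lambda>N. (?l N - ?r N) * x ^ N) sums 0" by (simp add: left_diff_distrib)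
  qed auto
  thus ?thesis by simp
qed

theorem theorem5p3:
  fixes n :: nat
  shows "(\<Sum>p\<le>2*n+1. real (p + 1) * mzsv (replicate (p + 1) 1 @ [(2*n+1-p) + 2]))
       - (\<Sum>p\<le>2*n+1. G ((2*n+1-p) + 2) 1 p)
       = real ((2*n+4) choose 3) * mzv [2*n+4]
         + (\<Sum>j=1..n. (-1) ^ j *
              (\<Sum>c \<in> {c :: nat list. length c = j + 1 \<and> sum_list c = 2*n+1-2*j}.
                  mzv ((hd c + 3) # map (\<lambda>x. x + 2) (tl c)) * W c))"
proof -
  let ?C = "\<lambda>j. {c :: nat list. length c = j + 1 \<and> sum_list c = 2*n+1-2*j}"
  let ?Z = "\<lambda>c. mzv ((hd c + 3) # map (\<lambda>x. x + 2) (tl c)) * W c"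
  \<comment> \<open>In odd degree, \<open>sum_list c\<close> + 2j = 2n + 1 forces j <= n, so the
    subtraction 2n + 1 - 2j is exact.\<close>
  have comps: "comps (2*n+1) = (\<Union>j\<in>{..n}. ?C j)"
  proof (intro set_eqI iffI)
    fix c assume "c \<in> comps (2*n+1)"
    hence "length c - 1 \<le> n" "c \<in> ?C (length c - 1)" by (auto simp: comps_def)
    thus "c \<in> (\<Union>j\<in>{..n}. ?C j)" by blast
  next
    fix c assume "c \<in> (\<Union>j\<in>{..n}. ?C j)"
    thus "c \<in> comps (2*n+1)" by (auto simp: comps_def)
  qed
  have fin: "finite (?C j)" if "j \<in> {..n}" for j
    by (rule finite_subset[OF _ finite_comps[of "2*n+1"]]) (use comps that in auto)
  have "(\<Sum>c\<in>comps (2*n+1). (-1) ^ (length c - 1) * ?Z c) = (\<Sum>j\<le>n. \<Sum>c\<in>?C j. (-1) ^ (length c - 1) * ?Z c)"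
    unfolding comps by (rule sum.UNION_disjoint) (use fin in auto)
  also have "\<dots> = (\<Sum>j\<le>n. (-1) ^ j * (\<Sum>c\<in>?C j. ?Z c))"
    by (intro sum.cong refl) (simp add: sum_distrib_left)
  \<comment> \<open>Depth 0 has the single list [2n+1] and gives the isolated zeta value.\<close>
  also have "{..n} = insert 0 {1..n}" by auto
  also have "(\<Sum>j\<in>insert 0 {1..n}. (-1) ^ j * (\<Sum>c\<in>?C j. ?Z c)) =
      (\<Sum>c\<in>?C 0. ?Z c) + (\<Sum>j=1..n. (-1) ^ j * (\<Sum>c\<in>?C j. ?Z c))" by simp
  also have "?C 0 = {[2*n+1]}" by (auto simp: length_Suc_conv)
  also have "(\<Sum>c\<in>{[2*n+1]}. ?Z c) = real ((2*n+4) choose 3) * mzv [2*n+4]"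
    by (simp add: W_def add_ac)
  finally show ?thesis unfolding left_side_eq_sum_comps[of "2*n+1"] .
qed

end
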